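(* Let $R$ be an integral domain. (0) Let $A \in \{\mathbb{A}\mathrm{ff}, \mathbb{A}\mathrm{ff}^+\}$. Every $\psi \in \mathrm{Aut}(A(R))$ induces an automorphism $\psi_{\mathrm{tf}}$ on the torsion-free part of the diagonal subgroup $\left(\begin{smallmatrix} * & 0 \\ 0 & 1\end{smallmatrix}\right) \cong A(R)/\mathbf{U}_2(R)$, and $R(\psi) \geq R(\psi_{\mathrm{tf}})$. (i) Let $n \geq 2$, let $G \in \{\mathbf{B}_n, \mathbb{P}\mathbf{B}_n\}$ (resp. $G^+ \in \{B_n^+, \mathbb{P}B_n^+\}$), and let $\varphi \in \mathrm{Aut}(G(R))$ (resp. $\varphi \in \mathrm{Aut}(G^+(R))$) be arbitrary. Then there exists an automorphism $\psi \in \mathrm{Aut}(\mathbb{A}\mathrm{ff}(R))$ (resp. $\psi \in \mathrm{Aut}(\mathbb{A}\mathrm{ff}^+(R))$) induced by $\varphi$ (in the sense described in the context) such that $R(\varphi) \geq R(\psi_{\mathrm{tf}})$, where $\psi_{\mathrm{tf}}$ denotes the automorphism induced by $\psi$ on the torsion-free part of $\mathbb{A}\mathrm{ff}(R)/\mathbf{U}_2(R)$ (resp. of $\mathbb{A}\mathrm{ff}^+(R)/\mathbf{U}_2(R)$). (ii) Assume that $R^\times$ is finitely generated. If, for $\varphi$ and $\psi$ as in (i), $\psi_{\mathrm{tf}}$ has infinitely many fixed points, then $R(\varphi) = \infty$. In particular, if every automorphism $\psi$ of $\mathbb{A}\mathrm{ff}(R)$ (resp. of $\mathbb{A}\mathrm{ff}^+(R)$)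 is such that $\psi_{\mathrm{tf}}$ has infinitely many fixed points, then for all $n \ge 2$ the groups $\mathbf{B}_n(R)$, $\mathbb{P}\mathbf{B}_n(R)$ and $\mathbb{A}\mathrm{ff}(R)$ (resp. $B_n^+(R)$, $\mathbb{P}B_n^+(R)$ and $\mathbb{A}\mathrm{ff}^+(R)$) have property $R_\infty$.
   Context: Twisted conjugacy. For a group $G$ and $\varphi\in\mathrm{Aut}(G)$, $R(\varphi) \in \{1,2,\dots\}\cup\{\infty\}$ is the Reidemeister number, i.e. the number of orbits of the action of $G$ on itself given by $h\cdot g = h g \varphi(h)^{-1}$ (all infinite values are written $\infty$). $G$ has property $R_\infty$ if $R(\varphi)=\infty$ for all $\varphi\in\mathrm{Aut}(G)$. Groups. $R$ is a commutative unital ring with unit group $R^\times$. $\mathbf{B}_n(R)\le \mathrm{GL}_n(R)$ is the group of upper triangular matrices, $\mathbf{U}_n(R)$ its subgroup of upper unitriangular matrices, $\mathbf{D}_n(R)$ the group of invertible diagonal matrices, $Z_n(R)=\{u\cdot \mathbf{1}_n \mid u \in R^\times\}$ the group of scalar matrices. $\mathbb{P}\mathbf{B}_n(R)=\mathbf{B}_n(R)/Z_n(R) = \mathbf{U}_n(R)\rtimes \mathbf{D}_n(R)/Z_n(R)$. $\mathbb{A}\mathrm{ff}(R)=\left\{\left(\begin{smallmatrix} u & r\\ 0& 1\end{smallmatrix}\right) \mid u\in R^\times, r\in R\right\}$. Let $t(R^\times)$ be the torsion subgroup of $R^\times$ and fix a complement $R^\times_{\mathrm{tf}}$, so that $R^\times=t(R^\times)\times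 R^\times_{\mathrm{tf}}$. Then $B_n^+(R)\le \mathbf{B}_n(R)$ is the subgroup of upper triangular matrices whose diagonal entries lie in $R^\times_{\mathrm{tf}}$; $\mathbb{P}B_n^+(R)$ is the quotient of $B_n^+(R)$ by the scalar matrices $u\cdot\mathbf{1}_n$ with $u\in R^\times_{\mathrm{tf}}$; and $\mathbb{A}\mathrm{ff}^+(R)=\left\{\left(\begin{smallmatrix} u & r\\ 0& 1\end{smallmatrix}\right) \mid u\in R^\times_{\mathrm{tf}}, r\in R\right\}$. $\mathbf{U}_n(R)$ is viewed as a normal subgroup of each projective group, and $\mathbf{U}_2(R)=\left(\begin{smallmatrix}1&*\\0&1\end{smallmatrix}\right)$ as a normal subgroup of $\mathbb{A}\mathrm{ff}(R)$ and $\mathbb{A}\mathrm{ff}^+(R)$. The torsion-free part of an abelian group $A$ with torsion subgroup $t(A)$ means $A/t(A)$; thus the torsion-free part of $\mathbb{A}\mathrm{ff}(R)/\mathbf{U}_2(R)\cong R^\times$ is $R^\times/t(R^\times)$, and $\mathbb{A}\mathrm{ff}^+(R)/\mathbf{U}_2(R)\cong R^\times_{\mathrm{tf}}$ is already torsion-free. Meaning of "induced by $\varphi$" in (i). If $\varphi$ is an automorphism of $\mathbf{B}_n(R)$ (resp. $B_n^+(R)$), first replace it by the automorphism it induces on the quotient $\mathbb{P}\mathbf{B}_n(R)$ (resp. $\mathbb{P}B_n^+(R)$). Let now $\varphi$ be an automorphism of $\mathbb{P}\mathbf{B}_n(R)$ (resp. $\mathbb{P}B_n^+(R)$). Write $e_{1,n}(r)$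 for the unitriangular matrix whose only possibly nonzero off-diagonal entry is $r$ in position $(1,n)$; these matrices form the center of $\mathbf{U}_n(R)$, and $\varphi$ restricts to this center as $\varphi(e_{1,n}(r))=e_{1,n}(\alpha(r))$ for some automorphism $\alpha$ of $(R,+)$. Moreover $\varphi$ induces an automorphism of the diagonal part (the quotient of the projective group by $\mathbf{U}_n(R)$) which preserves the subgroup of classes of diagonal matrices $\mathrm{Diag}(u_1,\dots,u_n)$ with $u_1=u_n$, hence induces an automorphism $\beta$ of the corresponding quotient, identified with $R^\times$ (resp. $R^\times_{\mathrm{tf}}$) via $\mathrm{Diag}(u_1,\dots,u_n)\mapsto u_1u_n^{-1}$. The induced automorphism is $\psi\left(\left(\begin{smallmatrix} u & r\\ 0& 1\end{smallmatrix}\right)\right)=\left(\begin{smallmatrix} \beta(u) & \alpha(r)\\ 0& 1\end{smallmatrix}\right)$. *)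

theory Defs
  imports
    "HOL-Algebra.Group_Action"
    "HOL-Algebra.Generated_Groups"
    "HOL-Library.Extended_Nat"
    "Jordan_Normal_Form.Determinant"
begin

section \<open>Twisted conjugacy\<close>

text \<open>Automorphisms are the elements of the library set \<open>auto G\<close>, i.e. bijective endomorphisms that
  are extensional on the carrier of \<open>G\<close>.\<close>

definition reidemeister_number :: "('a, 'b) monoid_scheme \<Rightarrow> ('a \<Rightarrow> 'a) \<Rightarrow> enat" where
  "reidemeister_number G \<phi> =
     (let C = orbits G (carrier G) (\<lambda>h g. h \<otimes>\<^bsub>G\<^esub> g \<otimes>\<^bsub>G\<^esub> inv\<^bsub>G\<^esub> (\<phi> h))
      in if finite C then enat (card C) else \<infinity>)"

definition property_R_infinity :: "('a, 'b) monoid_scheme \<Rightarrow> bool" where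
  "property_R_infinity G \<longleftrightarrow> (\<forall>\<phi>\<in>auto G. reidemeister_number G \<phi> = \<infinity>)"

definition fixed_points :: "('a, 'b) monoid_scheme \<Rightarrow> ('a \<Rightarrow> 'a) \<Rightarrow> 'a set" where
  "fixed_points G \<phi> = {x \<in> carrier G. \<phi> x = x}"

definition finitely_generated :: "('a, 'b) monoid_scheme \<Rightarrow> bool" where
  "finitely_generated G \<longleftrightarrow> (\<exists>S. finite S \<and> S \<subseteq> carrier G \<and> generate G S = carrier G)"

definition torsion :: "('a, 'b) monoid_scheme \<Rightarrow> 'a set" where
  "torsion G = {x \<in> carrier G. \<exists>k::nat. k > 0 \<and> x [^]\<^bsub>G\<^esub> k = \<one>\<^bsub>G\<^esub>}"

definition torsion_free_part :: "('a, 'b) monoid_scheme \<Rightarrow> 'a set monoid" where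
  "torsion_free_part G = G Mod torsion G"

text \<open>The map induced on \<open>G/N\<close> sends a coset to its image under \<open>\<phi>\<close>. It lies in \<open>auto (G Mod N)\<close>
  only if \<open>\<phi>\<close> maps \<open>N\<close> onto \<open>N\<close>, and it then sends the class of \<open>x\<close> to the class of \<open>\<phi> x\<close>; see
  the lemmas below.\<close>

definition induced_map :: "('a, 'b) monoid_scheme \<Rightarrow> 'a set \<Rightarrow> ('a \<Rightarrow> 'a) \<Rightarrow> 'a set \<Rightarrow> 'a set" where
  "induced_map G N \<phi> = (\<lambda>X\<in>carrier (G Mod N). \<phi> ` X)"

lemma image_r_coset:
  assumes "group G" "N \<subseteq> carrier G" "\<phi> \<in> hom G G" "\<phi> ` N = N" "x \<in> carrier G"
  shows "\<phi> ` (N #>\<^bsub>G\<^esub> x) = N #>\<^bsub>G\<^esub> \<phi> x"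
proof -
  have "\<phi> ` (N #>\<^bsub>G\<^esub> x) = (\<lambda>h. \<phi> (h \<otimes>\<^bsub>G\<^esub> x)) ` N"
    by (auto simp: r_coset_def)
  also have "\<dots> = (\<lambda>h. \<phi> h \<otimes>\<^bsub>G\<^esub> \<phi> x) ` N"
    using assms by (intro image_cong) (auto simp: hom_def)
  also have "\<dots> = (\<lambda>h. h \<otimes>\<^bsub>G\<^esub> \<phi> x) ` (\<phi> ` N)"
    by (simp add: image_image)
  finally show ?thesis
    using assms(4) by (auto simp: r_coset_def)
qed

lemma induced_map_coset:
  assumes "group G" "N \<subseteq> carrier G" "\<phi> \<in> hom G G" "\<phi> ` N = N" "x \<in> carrier G"
  shows "induced_map G N \<phi> (N #>\<^bsub>G\<^esub> x) = N #>\<^bsub>G\<^esub> \<phi> x"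
  using image_r_coset[OF assms] assms(5) by (auto simp: induced_map_def carrier_FactGroup)

lemma induced_map_auto_imp_image:
  assumes "N \<lhd> G" "induced_map G N \<phi> \<in> auto (G Mod N)"
  shows "\<phi> ` N = N"
proof -
  interpret normal N G by fact
  interpret Q: group "G Mod N" by (rule factorgroup_is_group)
  have "induced_map G N \<phi> \<in> hom (G Mod N) (G Mod N)"
    using assms(2) by (simp add: auto_def)
  then have "induced_map G N \<phi> \<one>\<^bsub>G Mod N\<^esub> = \<one>\<^bsub>G Mod N\<^esub>"
    using Q.is_group hom_one by blast
  moreover have "induced_map G N \<phi> N = \<phi> ` N"
    using Q.one_closed by (simp add: induced_map_def)
  ultimately show ?thesis by simp
qed

section \<open>Units\<close>

definition unit_group :: "'a::idom monoid" where
  "unit_group = \<lparr>carrier = {x. x dvd 1}, Group.monoid.mult = (*), one = 1\<rparr>"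

definition torsion_complement :: "'a::idom set \<Rightarrow> bool" where
  "torsion_complement D \<longleftrightarrow> subgroup D unit_group \<and> torsion unit_group \<inter> D = {1} \<and>
     torsion unit_group <#>\<^bsub>unit_group\<^esub> D = carrier unit_group"

section \<open>Matrix groups\<close>

text \<open>The groups below depend on a group \<open>D\<close> of units, in which the diagonal entries lie.
  For \<open>D = carrier unit_group\<close> they are the groups \<open>B\<^sub>n(R)\<close>, \<open>PB\<^sub>n(R)\<close> and \<open>Aff(R)\<close>;
  for \<open>D\<close> a complement of the torsion units they are \<open>B\<^sub>n\<^sup>+(R)\<close>, \<open>PB\<^sub>n\<^sup>+(R)\<close> and \<open>Aff\<^sup>+(R)\<close>.
  Matrix indices start at 0, so position \<open>(1,n)\<close> is \<open>(0, n - 1)\<close>.\<close>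

definition GL :: "nat \<Rightarrow> 'a::idom mat monoid" where
  "GL n = units_of (ring_mat TYPE('a) n ())"

definition Borel :: "'a::idom set \<Rightarrow> nat \<Rightarrow> 'a mat monoid" where
  "Borel D n = (GL n)\<lparr>carrier :=
     {A \<in> carrier (GL n). upper_triangular A \<and> (\<forall>i<n. A $$ (i, i) \<in> D)}\<rparr>"

lemma carrier_Borel_units:
  "carrier (Borel (carrier unit_group) n) = {A \<in> carrier (GL n). upper_triangular A}"
proof -
  have "A $$ (i, i) dvd 1"
    if A: "A \<in> Units (ring_mat TYPE('a) n ())" "upper_triangular A" and i: "i < n"
    for A :: "'a mat" and i
  proof -
    from A obtain B where AB: "A \<in> carrier_mat n n" "B \<in> carrier_mat n n" "A * B = 1\<^sub>m n"
      by (auto simp: Units_def ring_mat_simps)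
    have "det A * det B = 1"
      using det_mult[OF AB(1,2)] AB(3) by simp
    then have "det A dvd 1"
      by (metis dvd_triv_left)
    moreover have "det A = (\<Prod>j<n. A $$ (j, j))"
      using det_upper_triangular[OF A(2) AB(1)] AB(1)
      by (simp add: diag_mat_def prod.distinct_set_conv_list[symmetric] atLeast0LessThan)
    moreover have "A $$ (i, i) dvd (\<Prod>j<n. A $$ (j, j))"
      using i by (intro dvd_prodI) auto
    ultimately show ?thesis
      by (metis dvd_trans)
  qed
  then show ?thesis
    by (auto simp: Borel_def GL_def unit_group_def units_of_def)
qed

definition unitri :: "nat \<Rightarrow> 'a::idom mat set" where
  "unitri n = {A \<in> carrier_mat n n. upper_triangular A \<and> (\<forall>i<n. A $$ (i, i) = 1)}"

definition scalars :: "'a::idom set \<Rightarrow> nat \<Rightarrow> 'a mat set" where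
  "scalars D n = {u \<cdot>\<^sub>m 1\<^sub>m n | u. u \<in> D}"

definition PBorel :: "'a::idom set \<Rightarrow> nat \<Rightarrow> 'a mat set monoid" where
  "PBorel D n = Borel D n Mod scalars D n"

definition proj_class :: "'a::idom set \<Rightarrow> nat \<Rightarrow> 'a mat \<Rightarrow> 'a mat set" where
  "proj_class D n A = scalars D n #>\<^bsub>Borel D n\<^esub> A"

definition aff_mat :: "'a::idom \<Rightarrow> 'a \<Rightarrow> 'a mat" where
  "aff_mat u r = mat_of_rows_list 2 [[u, r], [0, 1]]"

definition Aff :: "'a::idom set \<Rightarrow> 'a mat monoid" where
  "Aff D = (GL 2)\<lparr>carrier := {aff_mat u r | u r. u \<in> D}\<rparr>"

definition Aff_diag :: "'a::idom set \<Rightarrow> 'a mat set monoid" where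
  "Aff_diag D = Aff D Mod unitri 2"

definition aff_tf :: "'a::idom set \<Rightarrow> ('a mat \<Rightarrow> 'a mat) \<Rightarrow> ('a mat set set \<Rightarrow> 'a mat set set)" where
  "aff_tf D \<psi> = induced_map (Aff_diag D) (torsion (Aff_diag D)) (induced_map (Aff D) (unitri 2) \<psi>)"

section \<open>The automorphism of the affine group induced by one of the projective group\<close>

definition corner_mat :: "nat \<Rightarrow> 'a::idom \<Rightarrow> 'a mat" where
  "corner_mat n r = mat n n (\<lambda>(i, j). if i = j then 1 else if i = 0 \<and> j = n - 1 then r else 0)"

definition proj_unitri :: "'a::idom set \<Rightarrow> nat \<Rightarrow> 'a mat set set" where
  "proj_unitri D n = proj_class D n ` unitri n"

definition PBorel_diag :: "'a::idom set \<Rightarrow> nat \<Rightarrow> 'a mat set set monoid" where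
  "PBorel_diag D n = PBorel D n Mod proj_unitri D n"

definition diag_class :: "'a::idom set \<Rightarrow> nat \<Rightarrow> (nat \<Rightarrow> 'a) \<Rightarrow> 'a mat set set" where
  "diag_class D n u = proj_unitri D n #>\<^bsub>PBorel D n\<^esub> proj_class D n (mat_diag n u)"

definition equal_ends :: "'a::idom set \<Rightarrow> nat \<Rightarrow> 'a mat set set set" where
  "equal_ends D n = {diag_class D n u | u. (\<forall>i<n. u i \<in> D) \<and> u 0 = u (n - 1)}"

text \<open>\<open>corner_ratio D n \<chi> \<beta>\<close>: under the identification of the quotient of the diagonal part by
  \<open>equal_ends D n\<close> with \<open>D\<close> via \<open>Diag(u\<^sub>1,\<dots>,u\<^sub>n) \<mapsto> u\<^sub>1 u\<^sub>n\<^sup>-\<^sup>1\<close>,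
  the automorphism \<open>\<chi>\<close> of that quotient corresponds to \<open>\<beta>\<close>.\<close>

definition corner_ratio ::
  "'a::idom set \<Rightarrow> nat \<Rightarrow> ('a mat set set set \<Rightarrow> 'a mat set set set) \<Rightarrow> ('a \<Rightarrow> 'a) \<Rightarrow> bool" where
  "corner_ratio D n \<chi> \<beta> \<longleftrightarrow>
     (\<forall>u v. (\<forall>i<n. u i \<in> D) \<and> (\<forall>i<n. v i \<in> D) \<and>
        \<chi> (equal_ends D n #>\<^bsub>PBorel_diag D n\<^esub> diag_class D n u)
          = equal_ends D n #>\<^bsub>PBorel_diag D n\<^esub> diag_class D n v \<longrightarrow>
        \<beta> (u 0 * inv\<^bsub>unit_group\<^esub> (u (n - 1))) = v 0 * inv\<^bsub>unit_group\<^esub> (v (n - 1)))"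

definition induces_aff ::
  "'a::idom set \<Rightarrow> nat \<Rightarrow> ('a mat set \<Rightarrow> 'a mat set) \<Rightarrow> ('a mat \<Rightarrow> 'a mat) \<Rightarrow> bool" where
  "induces_aff D n \<phi> \<psi> \<longleftrightarrow>
     \<phi> \<in> auto (PBorel D n) \<and> \<psi> \<in> auto (Aff D) \<and>
     (let \<phi>d = induced_map (PBorel D n) (proj_unitri D n) \<phi>;
          \<chi> = induced_map (PBorel_diag D n) (equal_ends D n) \<phi>d
      in \<phi>d \<in> auto (PBorel_diag D n) \<and>
         \<phi>d ` equal_ends D n = equal_ends D n \<and>
         \<chi> \<in> auto (PBorel_diag D n Mod equal_ends D n) \<and>
         (\<exists>\<alpha> \<beta>.
            bij \<alpha> \<and> (\<forall>r s. \<alpha> (r + s) = \<alpha> r + \<alpha> s) \<and>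
            (\<forall>r. \<phi> (proj_class D n (corner_mat n r)) = proj_class D n (corner_mat n (\<alpha> r))) \<and>
            \<beta> \<in> auto (unit_group\<lparr>carrier := D\<rparr>) \<and> corner_ratio D n \<chi> \<beta> \<and>
            (\<forall>u\<in>D. \<forall>r. \<psi> (aff_mat u r) = aff_mat (\<beta> u) (\<alpha> r))))"

text \<open>An automorphism of the linear group is first passed to the projective quotient.\<close>

definition Borel_induces_aff ::
  "'a::idom set \<Rightarrow> nat \<Rightarrow> ('a mat \<Rightarrow> 'a mat) \<Rightarrow> ('a mat \<Rightarrow> 'a mat) \<Rightarrow> bool" where
  "Borel_induces_aff D n \<phi> \<psi> \<longleftrightarrow> induces_aff D n (induced_map (Borel D n) (scalars D n) \<phi>) \<psi>"

end

theory Submission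
  imports Defs
begin

text \<open>In the projective group \<open>PB\<^sub>n\<close>, taking iterated commutators of an elementary matrix with an
  element that has two different adjacent diagonal entries \<open>a\<close>, \<open>d\<close> multiplies its entry by
  \<open>(d - a)/a\<close> each time, so it never vanishes over a domain. Hence \<open>U\<^sub>n\<close> is exactly the set of left Engel elements and is
  characteristic, and so is its center, the corner subgroup. The conjugation action on the corner
  subgroup is multiplication by \<open>u\<^sub>1 u\<^sub>n\<^sup>-\<^sup>1\<close>, so an automorphism acts compatibly on the
  corner entry and on this ratio, which gives \<open>\<psi>\<close>; Reidemeister numbers do not increase along
  equivariant surjections.

  For (ii), the torsion-free part is an abelian group of finite rank. If \<open>R(\<chi>)\<close> were finite, every
  element would have a power in the image of \<open>h \<mapsto> h \<chi>(h)\<^sup>-\<^sup>1\<close>, so that this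
  endomorphism would preserve the rank, against its nontrivial kernel.\<close>

text \<open>The commutator subgroup could not replace the Engel set: for units \<open>u\<close> the
  element \<open>u - 1\<close> need not be invertible, so commutators may generate only a proper
  part of \<open>unitri n\<close>, and for \<open>D = {1}\<close> the whole group is unitriangular.
  The Engel condition asks only that \<open>d - a\<close> be nonzero and treats every
  \<open>D\<close> alike. It is applied in \<open>PBorel\<close> because in \<open>Borel\<close> all
  scalar multiples of unitriangular matrices are left Engel too. Descending from
  \<open>Borel\<close> to \<open>PBorel\<close> requires the scalars to be invariant. They form the
  center once \<open>D\<close> contains an element other than 1, and are trivial otherwise. The
  additive bijection \<alpha> need not be linear. Comparing conjugation before and after \<phi>
  gives \<open>\<alpha> (u * r) = \<beta> u * \<alpha> r\<close>, which both determines \<beta> and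
  is what multiplicativity of \<psi> amounts to. Part (ii) speaks of every \<psi> related to \<phi>,
  not just the constructed one. The inequality is therefore derived from the relation
  \<open>induces_aff\<close> alone, with \<beta> controlled through
  \<open>corner_ratio\<close>.\<close>

section \<open>Automorphisms, invariant subsets and quotients\<close>

lemma auto_iff:
  "\<phi> \<in> auto G \<longleftrightarrow> \<phi> \<in> hom G G \<and> \<phi> \<in> extensional (carrier G) \<and> bij_betw \<phi> (carrier G) (carrier G)"
  by (auto simp: auto_def Bij_def)

lemma auto_hom: "\<phi> \<in> auto G \<Longrightarrow> \<phi> \<in> hom G G"
  and auto_bij: "\<phi> \<in> auto G \<Longrightarrow> bij_betw \<phi> (carrier G) (carrier G)"
  by (auto simp: auto_iff)

lemma auto_closed: "\<phi> \<in> auto G \<Longrightarrow> x \<in> carrier G \<Longrightarrow> \<phi> x \<in> carrier G"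
  by (auto simp: auto_iff bij_betw_def)

lemma auto_eq_iff:
  "\<phi> \<in> auto G \<Longrightarrow> x \<in> carrier G \<Longrightarrow> y \<in> carrier G \<Longrightarrow> \<phi> x = \<phi> y \<longleftrightarrow> x = y"
  using auto_bij[of \<phi> G] by (auto simp: bij_betw_def inj_on_def)

lemma auto_group_hom: "group G \<Longrightarrow> \<phi> \<in> auto G \<Longrightarrow> group_hom G G \<phi>"
  by (simp add: group_hom_def group_hom_axioms_def auto_hom)

text \<open>As \<phi> is onto, a subset cut out by a property that \<phi> preserves and reflects is
  mapped onto itself. Centralizers, left Engel elements, torsion and the kernel of
  \<open>proj_quot\<close> are all handled this way.\<close>

lemma auto_image_Collect:
  assumes "\<phi> \<in> auto G" "\<And>x. x \<in> carrier G \<Longrightarrow> P (\<phi> x) \<longleftrightarrow> P x"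
  shows "\<phi> ` {x \<in> carrier G. P x} = {x \<in> carrier G. P x}"
proof -
  have "\<phi> ` {x \<in> carrier G. P x} = \<phi> ` {x \<in> carrier G. P (\<phi> x)}"
    using assms(2) by auto
  also have "\<dots> = {y \<in> \<phi> ` carrier G. P y}"
    by auto
  finally show ?thesis
    using auto_bij[OF assms(1)] by (simp add: bij_betw_def)
qed

lemma auto_restrictI:
  assumes "f \<in> hom G G" "bij_betw f (carrier G) (carrier G)" "group G"
  shows "restrict f (carrier G) \<in> auto G"
proof -
  have "x \<otimes>\<^bsub>G\<^esub> y \<in> carrier G" if "x \<in> carrier G" "y \<in> carrier G" for x y
    using that assms(3) by (simp add: group.is_monoid monoid.m_closed)
  then show ?thesis
    using assms by (auto simp: auto_iff hom_def bij_betw_restrict_eq Pi_iff cong: bij_betw_cong)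
qed

definition centralizer :: "('a, 'b) monoid_scheme \<Rightarrow> 'a set \<Rightarrow> 'a set" where
  "centralizer G S = {x \<in> carrier G. \<forall>s\<in>S. x \<otimes>\<^bsub>G\<^esub> s = s \<otimes>\<^bsub>G\<^esub> x}"

lemma auto_image_centralizer:
  assumes "group G" "\<phi> \<in> auto G" "S \<subseteq> carrier G" "\<phi> ` S = S"
  shows "\<phi> ` centralizer G S = centralizer G S"
  unfolding centralizer_def
proof (rule auto_image_Collect[OF assms(2)])
  interpret group G by fact
  fix x assume x: "x \<in> carrier G"
  have "(\<forall>s\<in>S. \<phi> x \<otimes>\<^bsub>G\<^esub> s = s \<otimes>\<^bsub>G\<^esub> \<phi> x) \<longleftrightarrow>
      (\<forall>s\<in>S. \<phi> x \<otimes>\<^bsub>G\<^esub> \<phi> s = \<phi> s \<otimes>\<^bsub>G\<^esub> \<phi> x)"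
    \<comment> \<open>Since \<phi> maps \<open>S\<close> onto itself, testing against all of
      \<open>S\<close> means testing against all \<open>\<phi> s\<close>.\<close>
    by (subst (1) assms(4)[symmetric]) auto
  also have "\<dots> \<longleftrightarrow> (\<forall>s\<in>S. \<phi> (x \<otimes>\<^bsub>G\<^esub> s) = \<phi> (s \<otimes>\<^bsub>G\<^esub> x))"
    using x assms(3) auto_hom[OF assms(2)] by (intro ball_cong) (auto simp: hom_mult subset_iff)
  also have "\<dots> \<longleftrightarrow> (\<forall>s\<in>S. x \<otimes>\<^bsub>G\<^esub> s = s \<otimes>\<^bsub>G\<^esub> x)"
    using x assms(3) by (intro ball_cong) (auto simp: auto_eq_iff[OF assms(2)] subset_iff)
  finally show "(\<forall>s\<in>S. \<phi> x \<otimes>\<^bsub>G\<^esub> s = s \<otimes>\<^bsub>G\<^esub> \<phi> x) \<longleftrightarrow>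
      (\<forall>s\<in>S. x \<otimes>\<^bsub>G\<^esub> s = s \<otimes>\<^bsub>G\<^esub> x)" .
qed

text \<open>Surjectivity lets every element of \<open>H\<close> be lifted. This yields normality of
  the image of \<open>unitri n\<close> in the projective group and of \<open>equal_ends\<close> in
  the diagonal quotient.\<close>

lemma normal_image_surj:
  assumes "N \<lhd> G" "group H" "f \<in> hom G H" "f ` carrier G = carrier H"
  shows "f ` N \<lhd> H"
proof -
  interpret normal N G by fact
  interpret H: group H by fact
  interpret f: group_hom G H f
    by unfold_locales (rule assms(3))
  show ?thesis
  proof (rule H.normalI)
    show "subgroup (f ` N) H"
      by (rule f.subgroup_img_is_subgroup[OF subgroup_axioms])
    show "\<forall>y\<in>carrier H. f ` N #>\<^bsub>H\<^esub> y = y <#\<^bsub>H\<^esub> f ` N"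
    proof
      fix y assume "y \<in> carrier H"
      then obtain x where x: "x \<in> carrier G" "y = f x"
        using assms(4) by auto
      have "f ` N #>\<^bsub>H\<^esub> y = f ` (N #>\<^bsub>G\<^esub> x)"
        using x subset by (force simp: r_coset_def image_iff)
      also have "N #>\<^bsub>G\<^esub> x = x <#\<^bsub>G\<^esub> N"
        using x coset_eq by simp
      also have "f ` (x <#\<^bsub>G\<^esub> N) = y <#\<^bsub>H\<^esub> f ` N"
        using x subset by (force simp: l_coset_def image_iff)
      finally show "f ` N #>\<^bsub>H\<^esub> y = y <#\<^bsub>H\<^esub> f ` N" .
    qed
  qed
qed

lemma comm_group_surj:
  assumes "comm_group G" "group H" "f \<in> hom G H" "f ` carrier G = carrier H"
  shows "comm_group H"
proof -
  interpret comm_group G by fact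
  show ?thesis
  proof (rule group.group_comm_groupI[OF assms(2)])
    fix x y assume "x \<in> carrier H" "y \<in> carrier H"
    then obtain a b where "a \<in> carrier G" "b \<in> carrier G" "x = f a" "y = f b"
      using assms(4) by (metis imageE)
    then show "x \<otimes>\<^bsub>H\<^esub> y = y \<otimes>\<^bsub>H\<^esub> x"
      using assms(3) by (metis hom_mult m_comm)
  qed
qed

lemma (in normal) r_coset_eq_iff:
  assumes "x \<in> carrier G" "y \<in> carrier G"
  shows "H #> x = H #> y \<longleftrightarrow> (\<exists>h\<in>H. x = h \<otimes> y)"
proof
  assume "H #> x = H #> y"
  then have "x \<in> H #> y"
    using rcos_self[OF assms(1) subgroup_axioms] by simp
  then show "\<exists>h\<in>H. x = h \<otimes> y"
    by (auto simp: r_coset_def)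
next
  assume "\<exists>h\<in>H. x = h \<otimes> y"
  then have "x \<in> H #> y"
    by (auto simp: r_coset_def)
  then show "H #> x = H #> y"
    using repr_independence[OF _ assms(2) subgroup_axioms] by simp
qed

lemma induced_map_auto:
  assumes "N \<lhd> G" "\<phi> \<in> auto G" "\<phi> ` N = N"
  shows "induced_map G N \<phi> \<in> auto (G Mod N)"
proof -
  interpret normal N G by fact
  interpret Q: group "G Mod N" by (rule factorgroup_is_group)
  note coset = induced_map_coset[OF is_group subset auto_hom[OF assms(2)] assms(3)]
  have "induced_map G N \<phi> \<in> hom (G Mod N) (G Mod N)"
  proof (rule homI)
    fix X assume "X \<in> carrier (G Mod N)"
    then show "induced_map G N \<phi> X \<in> carrier (G Mod N)"
      using auto_closed[OF assms(2)] by (auto simp: carrier_FactGroup coset)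
  next
    fix X Y assume "X \<in> carrier (G Mod N)" "Y \<in> carrier (G Mod N)"
    then obtain x y where xy: "x \<in> carrier G" "y \<in> carrier G" "X = N #>\<^bsub>G\<^esub> x" "Y = N #>\<^bsub>G\<^esub> y"
      by (auto simp: carrier_FactGroup)
    then show "induced_map G N \<phi> (X \<otimes>\<^bsub>G Mod N\<^esub> Y) =
        induced_map G N \<phi> X \<otimes>\<^bsub>G Mod N\<^esub> induced_map G N \<phi> Y"
      using auto_closed[OF assms(2)] auto_hom[OF assms(2)]
      by (simp add: coset rcos_sum hom_mult)
  qed
  moreover have "bij_betw (induced_map G N \<phi>) (carrier (G Mod N)) (carrier (G Mod N))"
  proof (rule bij_betw_imageI)
    show "inj_on (induced_map G N \<phi>) (carrier (G Mod N))"
    proof (rule inj_onI)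
      fix X Y assume "X \<in> carrier (G Mod N)" "Y \<in> carrier (G Mod N)"
        and eq: "induced_map G N \<phi> X = induced_map G N \<phi> Y"
      then obtain x y where xy: "x \<in> carrier G" "y \<in> carrier G" "X = N #>\<^bsub>G\<^esub> x" "Y = N #>\<^bsub>G\<^esub> y"
        by (auto simp: carrier_FactGroup)
      then have "N #>\<^bsub>G\<^esub> \<phi> x = N #>\<^bsub>G\<^esub> \<phi> y"
        using eq by (simp add: coset)
      \<comment> \<open>The element of \<open>N\<close> relating the images is itself of the form
        \<open>\<phi> m\<close> with \<open>m\<close> in \<open>N\<close>, so the relation can be
        pulled back through the injective \<phi>.\<close>
      then obtain m where "m \<in> N" "\<phi> x = \<phi> m \<otimes>\<^bsub>G\<^esub> \<phi> y"
        using xy auto_closed[OF assms(2)] assms(3) r_coset_eq_iff by (metis imageE)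
      then have "\<phi> x = \<phi> (m \<otimes>\<^bsub>G\<^esub> y)" "m \<otimes>\<^bsub>G\<^esub> y \<in> carrier G"
        using xy auto_hom[OF assms(2)] subset by (auto simp: hom_mult subset_iff)
      then have "x = m \<otimes>\<^bsub>G\<^esub> y"
        using xy auto_eq_iff[OF assms(2)] by simp
      then show "X = Y"
        using xy \<open>m \<in> N\<close> r_coset_eq_iff by auto
    qed
    have "induced_map G N \<phi> ` carrier (G Mod N) = (\<lambda>x. N #>\<^bsub>G\<^esub> x) ` \<phi> ` carrier G"
      by (auto simp: carrier_FactGroup coset image_iff)
    then show "induced_map G N \<phi> ` carrier (G Mod N) = carrier (G Mod N)"
      using auto_bij[OF assms(2)] by (simp add: bij_betw_def carrier_FactGroup)
  qed
  ultimately show ?thesis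
    by (simp add: auto_iff induced_map_def)
qed

section \<open>Reidemeister numbers and equivariant maps\<close>

text \<open>The image under \<open>f\<close> of a twisted orbit is a whole twisted orbit of
  \<open>H\<close>, because \<open>f\<close> is onto the acting group and intertwines \<phi> with
  \<chi>. Hence the set of orbits of \<open>H\<close> is an image of that of
  \<open>G\<close>.\<close>

lemma reidemeister_number_mono:
  assumes "group G" "group H" "f \<in> hom G H" "f ` carrier G = carrier H"
    and "\<phi> \<in> carrier G \<rightarrow> carrier G" "\<And>x. x \<in> carrier G \<Longrightarrow> f (\<phi> x) = \<chi> (f x)"
  shows "reidemeister_number H \<chi> \<le> reidemeister_number G \<phi>"
proof -
  interpret f: group_hom G H f
    using assms(1-3) by (simp add: group_hom_def group_hom_axioms_def)
  define a where "a = (\<lambda>h g. h \<otimes>\<^bsub>G\<^esub> g \<otimes>\<^bsub>G\<^esub> inv\<^bsub>G\<^esub> (\<phi> h))"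
  define b where "b = (\<lambda>h g. h \<otimes>\<^bsub>H\<^esub> g \<otimes>\<^bsub>H\<^esub> inv\<^bsub>H\<^esub> (\<chi> h))"
  have ab: "f (a h g) = b (f h) (f g)" if "h \<in> carrier G" "g \<in> carrier G" for h g
    using that assms(5,6) by (auto simp: a_def b_def Pi_iff)
  have orb: "f ` orbit G a g = orbit H b (f g)" if "g \<in> carrier G" for g
  proof -
    have "f ` orbit G a g = (\<lambda>h. f (a h g)) ` carrier G"
      by (auto simp: orbit_def)
    also have "\<dots> = (\<lambda>h. b (f h) (f g)) ` carrier G"
      using that ab by (intro image_cong) auto
    also have "\<dots> = (\<lambda>h. b h (f g)) ` (f ` carrier G)"
      by (simp add: image_image)
    finally show ?thesis
      unfolding assms(4) by (auto simp: orbit_def)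
  qed
  have "orbits H (carrier H) b = (\<lambda>y. orbit H b y) ` f ` carrier G"
    unfolding assms(4) by (auto simp: orbits_def)
  also have "\<dots> = (\<lambda>X. f ` X) ` orbits G (carrier G) a"
    using orb by (force simp: orbits_def image_iff)
  finally have eq: "orbits H (carrier H) b = (\<lambda>X. f ` X) ` orbits G (carrier G) a" .
  show ?thesis
    using card_image_le[of "orbits G (carrier G) a" "\<lambda>X. f ` X"]
    by (auto simp: reidemeister_number_def Let_def a_def[symmetric] b_def[symmetric] eq)
qed

lemma reidemeister_number_induced_map_le:
  assumes "N \<lhd> G" "\<phi> \<in> auto G" "\<phi> ` N = N"
  shows "reidemeister_number (G Mod N) (induced_map G N \<phi>) \<le> reidemeister_number G \<phi>"
proof -
  interpret normal N G by fact
  show ?thesis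
    using auto_closed[OF assms(2)]
    by (intro reidemeister_number_mono[OF is_group factorgroup_is_group r_coset_hom_Mod])
      (auto simp: carrier_FactGroup induced_map_coset[OF is_group subset auto_hom[OF assms(2)] assms(3)])
qed

section \<open>Engel elements\<close>

text \<open>The left-normed commutator \<open>[x, g, ..., g]\<close> with \<open>k\<close> copies of
  \<open>g\<close>, under the convention \<open>[y, g] = y^-1 g^-1 y g\<close>.\<close>

primrec engel :: "('a, 'b) monoid_scheme \<Rightarrow> 'a \<Rightarrow> 'a \<Rightarrow> nat \<Rightarrow> 'a" where
  "engel G x g 0 = x"
| "engel G x g (Suc k) =
     inv\<^bsub>G\<^esub> (engel G x g k) \<otimes>\<^bsub>G\<^esub> inv\<^bsub>G\<^esub> g \<otimes>\<^bsub>G\<^esub> engel G x g k \<otimes>\<^bsub>G\<^esub> g"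

definition left_engel :: "('a, 'b) monoid_scheme \<Rightarrow> 'a set" where
  "left_engel G = {g \<in> carrier G. \<forall>x\<in>carrier G. \<exists>k. engel G x g k = \<one>\<^bsub>G\<^esub>}"

lemma (in group) engel_closed [simp]:
  "x \<in> carrier G \<Longrightarrow> g \<in> carrier G \<Longrightarrow> engel G x g k \<in> carrier G"
  by (induction k) auto

text \<open>Carries Engel computations from matrices to their projective classes, and from
  \<open>Aff D\<close> into \<open>Borel D 2\<close>.\<close>

lemma (in group_hom) hom_engel:
  "x \<in> carrier G \<Longrightarrow> g \<in> carrier G \<Longrightarrow> h (engel G x g k) = engel H (h x) (h g) k"
  by (induction k) auto

lemma auto_image_left_engel:
  assumes "group G" "\<phi> \<in> auto G"
  shows "\<phi> ` left_engel G = left_engel G"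
  unfolding left_engel_def
proof (rule auto_image_Collect[OF assms(2)])
  fix g assume g: "g \<in> carrier G"
  interpret group_hom G G \<phi>
    using assms by (rule auto_group_hom)
  have car: "carrier G = \<phi> ` carrier G"
    using auto_bij[OF assms(2)] by (simp add: bij_betw_def)
  have "(\<forall>x\<in>carrier G. \<exists>k. engel G x (\<phi> g) k = \<one>\<^bsub>G\<^esub>) \<longleftrightarrow>
      (\<forall>x\<in>carrier G. \<exists>k. \<phi> (engel G x g k) = \<phi> \<one>\<^bsub>G\<^esub>)"
    by (subst car) (simp add: hom_engel g)
  also have "\<dots> \<longleftrightarrow> (\<forall>x\<in>carrier G. \<exists>k. engel G x g k = \<one>\<^bsub>G\<^esub>)"
    using g by (simp add: auto_eq_iff[OF assms(2)] del: hom_one)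
  finally show "(\<forall>x\<in>carrier G. \<exists>k. engel G x (\<phi> g) k = \<one>\<^bsub>G\<^esub>) \<longleftrightarrow>
      (\<forall>x\<in>carrier G. \<exists>k. engel G x g k = \<one>\<^bsub>G\<^esub>)" .
qed

text \<open>Characterizes a commutator by multiplication alone, so that entries of a matrix
  commutator can be found without computing an inverse matrix.\<close>

lemma (in group) mult_commutator:
  assumes "x \<in> carrier G" "y \<in> carrier G"
  shows "y \<otimes> x \<otimes> (inv x \<otimes> inv y \<otimes> x \<otimes> y) = x \<otimes> y"
proof -
  have "a \<otimes> (inv a \<otimes> b) = b" if "a \<in> carrier G" "b \<in> carrier G" for a b
    using that by (simp add: m_assoc[symmetric])
  then show ?thesis
    using assms by (simp add: m_assoc)
qed

text \<open>Each commutator is a product of \<open>x\<close> or its inverse with a conjugate of the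
  other. The second form serves the first Engel step, where the normal subgroup contains the
  repeated argument and not the starting element.\<close>

lemma (in normal) commutator_closed:
  assumes "x \<in> H" "g \<in> carrier G"
  shows "inv x \<otimes> inv g \<otimes> x \<otimes> g \<in> H" "inv g \<otimes> inv x \<otimes> g \<otimes> x \<in> H"
proof -
  note closed = subgroup.m_closed[OF subgroup_axioms] subgroup.m_inv_closed[OF subgroup_axioms]
  have "inv x \<otimes> (inv g \<otimes> x \<otimes> g) \<in> H"
    by (rule closed(1)[OF closed(2)[OF assms(1)] inv_op_closed1[OF assms(2,1)]])
  then show "inv x \<otimes> inv g \<otimes> x \<otimes> g \<in> H"
    using assms subset by (simp add: m_assoc subset_iff)
  show "inv g \<otimes> inv x \<otimes> g \<otimes> x \<in> H"
    by (rule closed(1)[OF inv_op_closed1[OF assms(2) closed(2)[OF assms(1)]] assms(1)])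
qed

section \<open>Twisted conjugacy in torsion-free abelian groups of finite rank\<close>

lemma (in comm_group) subgroup_torsion: "subgroup (torsion G) G"
proof (rule subgroupI)
  show "torsion G \<subseteq> carrier G" "torsion G \<noteq> {}"
    by (auto simp: torsion_def intro!: exI[of _ \<one>] exI[of _ 1])
next
  fix x assume "x \<in> torsion G"
  then show "inv x \<in> torsion G"
    by (auto simp: torsion_def nat_pow_inv)
next
  fix x y assume "x \<in> torsion G" "y \<in> torsion G"
  then obtain k l :: nat where "x \<in> carrier G" "y \<in> carrier G" "k > 0" "x [^] k = \<one>" "l > 0" "y [^] l = \<one>"
    by (auto simp: torsion_def)
  moreover have "(x \<otimes> y) [^] (k * l) = (x [^] k) [^] l \<otimes> (y [^] l) [^] k"
    using \<open>x \<in> carrier G\<close> \<open>y \<in> carrier G\<close>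
    by (simp add: nat_pow_distrib nat_pow_pow mult.commute[of l k])
  ultimately show "x \<otimes> y \<in> torsion G"
    by (auto simp: torsion_def intro!: exI[of _ "k * l"])
qed

lemma auto_image_torsion:
  assumes "group G" "\<phi> \<in> auto G"
  shows "\<phi> ` torsion G = torsion G"
  unfolding torsion_def
proof (rule auto_image_Collect[OF assms(2)])
  fix x assume x: "x \<in> carrier G"
  interpret group_hom G G \<phi>
    using assms by (rule auto_group_hom)
  have "\<phi> x [^]\<^bsub>G\<^esub> k = \<one>\<^bsub>G\<^esub> \<longleftrightarrow> x [^]\<^bsub>G\<^esub> k = \<one>\<^bsub>G\<^esub>" for k :: nat
    using auto_eq_iff[OF assms(2), of "x [^]\<^bsub>G\<^esub> k" "\<one>\<^bsub>G\<^esub>"] x by (simp add: hom_nat_pow)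
  then show "(\<exists>k>0::nat. \<phi> x [^]\<^bsub>G\<^esub> k = \<one>\<^bsub>G\<^esub>) \<longleftrightarrow> (\<exists>k>0::nat. x [^]\<^bsub>G\<^esub> k = \<one>\<^bsub>G\<^esub>)"
    by simp
qed

text \<open>If a power of a class is trivial, that power of a representative is torsion; multiplying
  the two positive exponents makes the representative itself torsion.\<close>

lemma (in comm_group) torsion_free_part:
  shows "comm_group (torsion_free_part G)"
    and "\<And>x k::nat. x \<in> carrier (torsion_free_part G) \<Longrightarrow> x [^]\<^bsub>torsion_free_part G\<^esub> k = \<one>\<^bsub>torsion_free_part G\<^esub>
       \<Longrightarrow> k > 0 \<Longrightarrow> x = \<one>\<^bsub>torsion_free_part G\<^esub>"
proof -
  interpret N: normal "torsion G" G
    by (rule subgroup_imp_normal[OF subgroup_torsion])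
  show "comm_group (torsion_free_part G)"
    unfolding torsion_free_part_def by (rule abelian_FactGroup[OF subgroup_torsion])
  fix X and k :: nat
  assume X: "X \<in> carrier (torsion_free_part G)" and k: "k > 0"
    and one: "X [^]\<^bsub>torsion_free_part G\<^esub> k = \<one>\<^bsub>torsion_free_part G\<^esub>"
  then obtain x where x: "x \<in> carrier G" "X = torsion G #> x"
    by (auto simp: torsion_free_part_def carrier_FactGroup)
  then have "torsion G #> (x [^] k) = torsion G"
    using one by (simp add: torsion_free_part_def N.FactGroup_pow)
  then have "x [^] k \<in> torsion G"
    using rcos_self[OF nat_pow_closed[OF x(1)] N.subgroup_axioms] by metis
  then obtain l :: nat where "l > 0" "(x [^] k) [^] l = \<one>"
    unfolding torsion_def by blast
  then have "x [^] (k * l) = \<one>" "k * l > 0"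
    using x(1) k by (simp_all add: nat_pow_pow)
  then have "x \<in> torsion G"
    using x(1) unfolding torsion_def by blast
  then show "X = \<one>\<^bsub>torsion_free_part G\<^esub>"
    using x by (simp add: torsion_free_part_def N.rcos_const)
qed

section \<open>Integer relations and rank\<close>

definition int_comb :: "('a, 'b) monoid_scheme \<Rightarrow> (nat \<Rightarrow> 'a) \<Rightarrow> nat \<Rightarrow> (nat \<Rightarrow> int) \<Rightarrow> 'a" where
  "int_comb G x k c = finprod G (\<lambda>i. x i [^]\<^bsub>G\<^esub> c i) {..<k}"

definition dependent_tuple :: "('a, 'b) monoid_scheme \<Rightarrow> nat \<Rightarrow> (nat \<Rightarrow> 'a) \<Rightarrow> bool" where
  "dependent_tuple G k x \<longleftrightarrow> (\<exists>c. (\<exists>i<k. c i \<noteq> 0) \<and> int_comb G x k c = \<one>\<^bsub>G\<^esub>)"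

text \<open>For an abelian group this says that the torsion-free rank is below \<open>r\<close>,
  without forming the rational vector space.\<close>

definition bounded_rank :: "('a, 'b) monoid_scheme \<Rightarrow> nat \<Rightarrow> bool" where
  "bounded_rank G r \<longleftrightarrow> (\<forall>x. (\<forall>i<r. x i \<in> carrier G) \<longrightarrow> dependent_tuple G r x)"

context comm_group begin

lemma int_comb_0 [simp]: "int_comb G x 0 c = \<one>"
  by (simp add: int_comb_def)

lemma int_comb_closed [simp]:
  "(\<And>i. i < k \<Longrightarrow> x i \<in> carrier G) \<Longrightarrow> int_comb G x k c \<in> carrier G"
  by (auto simp: int_comb_def intro!: finprod_closed)

lemma int_comb_Suc:
  "(\<And>i. i < Suc k \<Longrightarrow> x i \<in> carrier G) \<Longrightarrow>
    int_comb G x (Suc k) c = int_comb G x k c \<otimes> x k [^] c k"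
  by (simp add: int_comb_def lessThan_Suc m_comm Pi_iff)

lemma int_comb_add:
  assumes "\<And>i. i < k \<Longrightarrow> x i \<in> carrier G"
  shows "int_comb G x k (\<lambda>i. c i + d i) = int_comb G x k c \<otimes> int_comb G x k d"
proof -
  have "int_comb G x k (\<lambda>i. c i + d i) = (\<Otimes>i\<in>{..<k}. x i [^] c i \<otimes> x i [^] d i)"
    unfolding int_comb_def using assms by (intro finprod_cong') (auto simp: int_pow_mult)
  then show ?thesis
    using assms by (simp add: int_comb_def Pi_iff)
qed

text \<open>Bases and exponents may change together as long as the single powers agree; this is how
  a factor moves from a base into an exponent.\<close>

lemma int_comb_cong:
  assumes "\<And>i. i < k \<Longrightarrow> x i [^] c i = y i [^] d i" "\<And>i. i < k \<Longrightarrow> y i \<in> carrier G"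
  shows "int_comb G x k c = int_comb G y k d"
  unfolding int_comb_def using assms by (intro finprod_cong') auto

lemma int_comb_mult:
  assumes "\<And>i. i < k \<Longrightarrow> x i \<in> carrier G"
  shows "int_comb G x k (\<lambda>i. c i * m) = int_comb G x k c [^] m"
  using assms
  by (induction k) (auto simp: int_comb_Suc int_pow_distrib int_pow_pow)

end

lemma (in group_hom) hom_int_comb:
  assumes "comm_group G" "comm_group H" "\<And>i. i < k \<Longrightarrow> x i \<in> carrier G"
  shows "h (int_comb G x k c) = int_comb H (\<lambda>i. h (x i)) k c"
  using assms(3)
  by (induction k)
    (auto simp: comm_group.int_comb_0[OF assms(1)] comm_group.int_comb_0[OF assms(2)]
      comm_group.int_comb_Suc[OF assms(1)] comm_group.int_comb_Suc[OF assms(2)]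
      comm_group.int_comb_closed[OF assms(1)] hom_int_pow int_pow_closed)

text \<open>A relation among arbitrary lifts maps to a relation with the same exponents.\<close>

lemma bounded_rank_surj:
  assumes "comm_group G" "comm_group H" "f \<in> hom G H" "f ` carrier G = carrier H" "bounded_rank G r"
  shows "bounded_rank H r"
  unfolding bounded_rank_def
proof (intro allI impI)
  interpret G: comm_group G by fact
  interpret H: comm_group H by fact
  interpret group_hom G H f by unfold_locales fact
  fix y assume "\<forall>i<r. y i \<in> carrier H"
  then have "\<forall>i<r. \<exists>x\<in>carrier G. y i = f x"
    using assms(4) by auto
  then obtain x where x: "\<And>i. i < r \<Longrightarrow> x i \<in> carrier G \<and> y i = f (x i)"
    by metis
  then obtain c where c: "\<exists>i<r. c i \<noteq> (0::int)" "int_comb G x r c = \<one>\<^bsub>G\<^esub>"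
    using assms(5) unfolding bounded_rank_def dependent_tuple_def by blast
  have "int_comb H y r c = int_comb H (\<lambda>i. f (x i)) r c"
    using x by (intro H.int_comb_cong) auto
  also have "\<dots> = \<one>\<^bsub>H\<^esub>"
    using x c(2) by (simp add: hom_int_comb[OF assms(1,2), symmetric])
  finally show "dependent_tuple H r y"
    using c(1) by (auto simp: dependent_tuple_def)
qed

lemma bounded_rank_subgroup:
  assumes "comm_group G" "subgroup S G" "bounded_rank G r"
  shows "bounded_rank (G\<lparr>carrier := S\<rparr>) r"
  unfolding bounded_rank_def
proof (intro allI impI)
  interpret G: comm_group G by fact
  interpret subgroup S G by fact
  have S: "comm_group (G\<lparr>carrier := S\<rparr>)"
    using G.m_comm subset
    by (intro group.group_comm_groupI[OF subgroup_is_group[OF G.is_group]]) (auto simp: subset_iff)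
  interpret S: comm_group "G\<lparr>carrier := S\<rparr>" by (rule S)
  interpret group_hom "G\<lparr>carrier := S\<rparr>" G id
    by unfold_locales (auto simp: hom_def)
  fix x assume x: "\<forall>i<r. x i \<in> carrier (G\<lparr>carrier := S\<rparr>)"
  then have "\<forall>i<r. x i \<in> carrier G" by auto
  then obtain c where c: "\<exists>i<r. c i \<noteq> (0::int)" "int_comb G x r c = \<one>\<^bsub>G\<^esub>"
    using assms(3) unfolding bounded_rank_def dependent_tuple_def by blast
  have "int_comb (G\<lparr>carrier := S\<rparr>) x r c = \<one>\<^bsub>G\<lparr>carrier := S\<rparr>\<^esub>"
    using hom_int_comb[OF S assms(1), of r x c] x c(2) by simp
  then show "dependent_tuple (G\<lparr>carrier := S\<rparr>) r x"
    using c(1) by (auto simp: dependent_tuple_def)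
qed

lemma (in comm_group) generate_imp_int_comb:
  assumes "x \<in> generate G (g ` {..<r})" "g ` {..<r} \<subseteq> carrier G"
  shows "\<exists>c. x = int_comb G g r c"
  using assms(1)
proof induction
  case one
  show ?case
    using assms(2) by (intro exI[of _ "\<lambda>_. 0"]) (simp add: int_comb_def)
next
  case (incl h)
  then obtain j where j: "j < r" "h = g j" by auto
  have "int_comb G g r (\<lambda>i. if i = j then 1 else 0) = (\<Otimes>i\<in>{..<r}. if j = i then g i else \<one>)"
    unfolding int_comb_def using assms(2) by (intro finprod_cong') (auto simp: int_pow_1)
  also have "\<dots> = h"
    using j assms(2) by (subst finprod_singleton) auto
  finally show ?case by metis
next
  case (inv h)
  then obtain j where j: "j < r" "h = g j" by auto
  have "int_comb G g r (\<lambda>i. if i = j then -1 else 0) = (\<Otimes>i\<in>{..<r}. if j = i then inv (g i) else \<one>)"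
    unfolding int_comb_def using assms(2) by (intro finprod_cong') (auto simp: int_pow_neg int_pow_1)
  also have "\<dots> = inv h"
    using j assms(2) by (subst finprod_singleton) auto
  finally show ?case by metis
next
  case (eng h1 h2)
  then obtain c d where "h1 = int_comb G g r c" "h2 = int_comb G g r d" by auto
  then show ?case
    using assms(2) by (intro exI[of _ "\<lambda>i. c i + d i"]) (subst int_comb_add, auto)
qed

text \<open>Adding a zero row to the exponent matrix of \<open>r + 1\<close> products of \<open>r\<close> generators makes it
  square and singular; an integral kernel vector is a relation.\<close>

lemma (in comm_group) finitely_generated_imp_bounded_rank:
  assumes "finitely_generated G"
  shows "\<exists>r. bounded_rank G r"
proof -
  obtain S where S: "finite S" "S \<subseteq> carrier G" "generate G S = carrier G"
    using assms by (auto simp: finitely_generated_def)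
  obtain r and g :: "nat \<Rightarrow> 'a" where g: "S = g ` {..<r}"
    using finite_imp_nat_seg_image_inj_on[OF S(1)] unfolding lessThan_def by metis
  have gc: "\<And>i. i < r \<Longrightarrow> g i \<in> carrier G"
    using S(2) g by auto
  have "bounded_rank G (Suc r)"
    unfolding bounded_rank_def
  proof (intro allI impI)
    fix x assume x: "\<forall>i<Suc r. x i \<in> carrier G"
    then have "\<forall>i<Suc r. \<exists>a. x i = int_comb G g r a"
      using generate_imp_int_comb[of _ g r] S g by blast
    then obtain a where a: "\<And>i. i < Suc r \<Longrightarrow> x i = int_comb G g r (a i)"
      by metis
    \<comment> \<open>Row \<open>j\<close> belongs to the generator \<open>g j\<close> and column
      \<open>i\<close> to the element \<open>x i\<close>; row \<open>r\<close> is the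
      padding.\<close>
    define A where "A = mat (Suc r) (Suc r) (\<lambda>(j, i). if j = r then 0 else a i j)"
    have A: "A \<in> carrier_mat (Suc r) (Suc r)"
      by (simp add: A_def)
    have "A = mat\<^sub>r (Suc r) (Suc r) (\<lambda>j. if j = r then 0\<^sub>v (Suc r) else vec (Suc r) (\<lambda>i. a i j))"
      by (rule eq_matI) (auto simp: A_def)
    then have "det A = 0"
      using det_row_0[of r "Suc r" "\<lambda>j. vec (Suc r) (\<lambda>i. a i j)"] by auto
    then obtain v where v: "v \<in> carrier_vec (Suc r)" "v \<noteq> 0\<^sub>v (Suc r)" "A *\<^sub>v v = 0\<^sub>v (Suc r)"
      using det_0_iff_vec_prod_zero[OF A] by auto
    have rel: "(\<Sum>i<Suc r. a i j * v $ i) = 0" if "j < r" for j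
    proof -
      have "(\<Sum>i<Suc r. a i j * v $ i) = (A *\<^sub>v v) $ j"
        using that v(1) by (auto simp: A_def scalar_prod_def lessThan_atLeast0 intro!: sum.cong)
      then show ?thesis
        using v(3) that by simp
    qed
    \<comment> \<open>Stated for initial segments so that induction multiplies in one element at a
      time. At full length the inner sums are entries of the zero vector
      \<open>A *\<^sub>v v\<close>.\<close>
    have comb: "int_comb G x m (\<lambda>i. v $ i) = int_comb G g r (\<lambda>j. \<Sum>i<m. a i j * v $ i)"
      if "m \<le> Suc r" for m
      using that
    proof (induction m)
      case 0
      then show ?case by (simp add: int_comb_def)
    next
      case (Suc m)
      show ?case
        using Suc x a gc
        by (subst int_comb_Suc) (auto simp: int_comb_mult int_comb_add)
    qed
    have "int_comb G x (Suc r) (\<lambda>i. v $ i) = int_comb G g r (\<lambda>j. 0)"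
      using comb[of "Suc r"] rel gc by (auto intro!: int_comb_cong simp del: sum.lessThan_Suc)
    also have "\<dots> = \<one>"
      using gc by (simp add: int_comb_def)
    finally show "dependent_tuple G (Suc r) x"
      unfolding dependent_tuple_def using v(1,2) by (intro exI[of _ "\<lambda>i. v $ i"]) auto
  qed
  then show ?thesis ..
qed

text \<open>By the pigeonhole principle two powers of \<open>x\<close> with exponents
  \<open>i < j\<close> are twisted conjugate through some \<open>h\<close>. Commutativity allows the
  power with exponent \<open>i\<close> to be cancelled, leaving exponent
  \<open>j - i\<close>.\<close>

lemma (in comm_group) finite_twisted_orbits_imp_power:
  assumes "\<chi> \<in> hom G G" "finite (orbits G (carrier G) (\<lambda>h g. h \<otimes> g \<otimes> inv (\<chi> h)))"
    and x: "x \<in> carrier G"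
  shows "\<exists>m::nat. m > 0 \<and> (\<exists>h\<in>carrier G. h \<otimes> inv (\<chi> h) = x [^] m)"
proof -
  interpret \<chi>: group_hom G G \<chi> by unfold_locales fact
  define a where "a = (\<lambda>h g. h \<otimes> g \<otimes> inv (\<chi> h))"
  have "(\<lambda>i::nat. orbit G a (x [^] i)) ` UNIV \<subseteq> orbits G (carrier G) a"
    using x by (auto simp: orbits_def)
  then have "\<not> inj (\<lambda>i::nat. orbit G a (x [^] i))"
    using assms(2) unfolding a_def[symmetric] by (meson finite_imageD finite_subset infinite_UNIV_nat)
  then obtain i j :: nat where ij: "i < j" "orbit G a (x [^] i) = orbit G a (x [^] j)"
    unfolding inj_def by (metis linorder_neqE_nat)
  have "a \<one> (x [^] j) = x [^] j"
    using x by (simp add: a_def)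
  then have "x [^] j \<in> orbit G a (x [^] j)"
    unfolding orbit_def using one_closed by (metis (mono_tags, lifting) mem_Collect_eq)
  then obtain h where h: "h \<in> carrier G" "x [^] j = a h (x [^] i)"
    unfolding ij(2)[symmetric] by (auto simp: orbit_def)
  have "h \<otimes> inv (\<chi> h) \<otimes> x [^] i = x [^] (j - i) \<otimes> x [^] i"
    using h x ij(1) by (simp add: nat_pow_mult a_def m_ac)
  then have "h \<otimes> inv (\<chi> h) = x [^] (j - i)"
    using h(1) x by (metis right_cancel m_closed inv_closed nat_pow_closed \<chi>.hom_closed)
  then show ?thesis
    using ij(1) h(1) by (intro exI[of _ "j - i"]) auto
qed

text \<open>Lifting powers of the members of an independent tuple along the endomorphism
  \<open>h \<mapsto> h \<chi>(h)\<^sup>-\<^sup>1\<close>, and adding a nontrivial element of its kernel, gives a longer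
  independent tuple.\<close>

lemma (in comm_group) reidemeister_number_infinite:
  assumes tf: "\<And>x k::nat. x \<in> carrier G \<Longrightarrow> x [^] k = \<one> \<Longrightarrow> k > 0 \<Longrightarrow> x = \<one>"
    and rank: "bounded_rank G r" and \<chi>: "\<chi> \<in> hom G G" and inf: "infinite (fixed_points G \<chi>)"
  shows "reidemeister_number G \<chi> = \<infinity>"
proof (rule ccontr)
  assume "reidemeister_number G \<chi> \<noteq> \<infinity>"
  then have fin: "finite (orbits G (carrier G) (\<lambda>h g. h \<otimes> g \<otimes> inv (\<chi> h)))"
    by (auto simp: reidemeister_number_def Let_def split: if_splits)
  have tf_int: "c = 0" if "x \<in> carrier G" "x [^] c = \<one>" "x \<noteq> \<one>" for x and c :: int
  proof (cases c rule: int_cases2)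
    case (nonneg n)
    then show ?thesis
      using tf[OF that(1), of n] that(2,3) by (auto simp: int_pow_int)
  next
    case (nonpos n)
    then have "x [^] n = \<one>"
      using that(1,2) by (simp add: int_pow_neg_int inv_eq_1_iff)
    then show ?thesis
      using tf[OF that(1), of n] that(3) nonpos by auto
  qed
  interpret \<chi>: group_hom G G \<chi> by unfold_locales fact
  \<comment> \<open>An infinite set of fixed points contains more than \<one>. This \<open>z\<close>
    is the nontrivial kernel element of \<theta>.\<close>
  obtain z where z: "z \<in> carrier G" "\<chi> z = z" "z \<noteq> \<one>"
    using inf by (metis (mono_tags, lifting) fixed_points_def finite.simps finite_subset insertI1
        mem_Collect_eq subsetI)
  define \<theta> where "\<theta> h = h \<otimes> inv (\<chi> h)" for h
  interpret \<theta>: group_hom G G \<theta>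
    by unfold_locales (auto simp: hom_def \<theta>_def inv_mult m_ac)
  have "\<exists>x. (\<forall>i<k. x i \<in> carrier G) \<and> \<not> dependent_tuple G k x" for k
  proof (induction k)
    case 0
    \<comment> \<open>The empty tuple is independent, since a relation must have a nonzero
      exponent.\<close>
    show ?case by (auto simp: dependent_tuple_def)
  next
    case (Suc k)
    then obtain x where x: "\<And>i. i < k \<Longrightarrow> x i \<in> carrier G" "\<not> dependent_tuple G k x"
      by blast
    have "\<forall>i<k. \<exists>m::nat. m > 0 \<and> (\<exists>h\<in>carrier G. \<theta> h = x i [^] m)"
      using finite_twisted_orbits_imp_power[OF \<chi> fin] x(1) by (auto simp: \<theta>_def)
    then obtain m :: "nat \<Rightarrow> nat" and y
      where y: "\<And>i. i < k \<Longrightarrow> m i > 0" "\<And>i. i < k \<Longrightarrow> y i \<in> carrier G" "\<And>i. i < k \<Longrightarrow> \<theta> (y i) = x i [^] m i"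
      by metis
    define w where "w i = (if i < k then y i else z)" for i
    have w: "w i \<in> carrier G" for i
      using y(2) z(1) by (simp add: w_def)
    have "\<not> dependent_tuple G (Suc k) w"
    proof
      assume "dependent_tuple G (Suc k) w"
      then obtain c where c: "\<exists>i<Suc k. c i \<noteq> (0::int)" "int_comb G w (Suc k) c = \<one>"
        by (auto simp: dependent_tuple_def)
      then have split: "int_comb G w k c \<otimes> z [^] c k = \<one>"
        using w by (simp add: int_comb_Suc) (simp add: w_def)
      \<comment> \<open>Applying \<theta> removes \<open>z\<close> and turns each lift
        \<open>y i\<close> into a power of \<open>x i\<close>. Independence of the
        \<open>x i\<close> forces \<open>m i * c i = 0\<close>, hence \<open>c i = 0\<close>; what
        remains is a power of \<open>z\<close>, and torsion-freeness gives
        \<open>c k = 0\<close>.\<close>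
      have "\<theta> z = \<one>"
        using z by (simp add: \<theta>_def)
      then have "\<theta> (int_comb G w k c) = \<one>"
        using arg_cong[OF split, of \<theta>] w z(1) by (simp add: \<theta>.hom_int_pow)
      moreover have "\<theta> (int_comb G w k c) = int_comb G (\<lambda>i. \<theta> (w i)) k c"
        using w by (intro \<theta>.hom_int_comb) (auto intro: comm_group_axioms)
      moreover have "int_comb G (\<lambda>i. \<theta> (w i)) k c = int_comb G x k (\<lambda>i. int (m i) * c i)"
      proof (rule int_comb_cong)
        fix i assume i: "i < k"
        have "\<theta> (w i) [^] c i = (x i [^] int (m i)) [^] c i"
          using i y(3) by (simp add: w_def int_pow_int)
        then show "\<theta> (w i) [^] c i = x i [^] (int (m i) * c i)"
          using x(1)[OF i] by (simp add: int_pow_pow)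
      qed (use x in auto)
      ultimately have "\<forall>i<k. int (m i) * c i = 0"
        using x(2) unfolding dependent_tuple_def by metis
      then have ck: "\<forall>i<k. c i = 0"
        using y(1) by fastforce
      have "int_comb G w k c = int_comb G w k (\<lambda>_. 0)"
        using ck w by (intro int_comb_cong) auto
      then have "z [^] c k = \<one>"
        using split z(1) by (simp add: int_comb_def)
      then have "c k = 0"
        using tf_int z by auto
      with ck c(1) show False
        by (auto simp: less_Suc_eq)
    qed
    then show ?case using w by blast
  qed
  then show False
    using rank unfolding bounded_rank_def by blast
qed

section \<open>Upper triangular matrices\<close>

lemma mult_mat_entry:
  assumes "A \<in> carrier_mat n n" "B \<in> carrier_mat n n" "i < n" "j < n"
  shows "(A * B) $$ (i, j) = (\<Sum>l<n. A $$ (i, l) * B $$ (l, j))"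
  using assms by (auto simp: scalar_prod_def atLeast0LessThan)

text \<open>The filtration by superdiagonals: \<open>band 0\<close> is upper triangularity,
  \<open>band 1\<close> strict upper triangularity, and an \<open>n\<close> by \<open>n\<close>
  matrix with \<open>band n\<close> is zero.\<close>

definition band :: "nat \<Rightarrow> 'a::zero mat \<Rightarrow> bool" where
  "band k A \<longleftrightarrow> (\<forall>i<dim_row A. \<forall>j<dim_col A. j < i + k \<longrightarrow> A $$ (i, j) = 0)"

lemma bandD: "band k A \<Longrightarrow> A \<in> carrier_mat n n \<Longrightarrow> i < n \<Longrightarrow> j < n \<Longrightarrow> j < i + k \<Longrightarrow> A $$ (i, j) = 0"
  by (auto simp: band_def)

lemma band_0_iff: "A \<in> carrier_mat n n \<Longrightarrow> band 0 A \<longleftrightarrow> upper_triangular A"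
  by (auto simp: band_def upper_triangular_def)

lemma band_minus:
  fixes A B :: "'a::group_add mat"
  shows "A \<in> carrier_mat n n \<Longrightarrow> B \<in> carrier_mat n n \<Longrightarrow> band k A \<Longrightarrow> band k B \<Longrightarrow> band k (A - B)"
  by (auto simp: band_def)

text \<open>If \<open>j < i + (a + b)\<close>, every intermediate index \<open>l\<close> satisfies
  \<open>l < i + a\<close> or \<open>j < l + b\<close>, so one of the two factors vanishes.\<close>

lemma band_mult:
  fixes A B :: "'a::semiring_0 mat"
  assumes "A \<in> carrier_mat n n" "B \<in> carrier_mat n n" "band a A" "band b B"
  shows "band (a + b) (A * B)"
  unfolding band_def
proof (intro allI impI)
  fix i j assume "i < dim_row (A * B)" "j < dim_col (A * B)" and ij: "j < i + (a + b)"
  then have i: "i < n" "j < n"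
    using assms by auto
  have "A $$ (i, l) * B $$ (l, j) = 0" if "l < n" for l
  proof (cases "l < i + a")
    case True
    then show ?thesis using bandD[OF assms(3,1)] i that by simp
  next
    case False
    then have "j < l + b" using ij by simp
    then show ?thesis using bandD[OF assms(4,2)] i that by simp
  qed
  then show "(A * B) $$ (i, j) = 0"
    using i assms(1,2) by (auto simp: scalar_prod_def intro!: sum.neutral)
qed

lemma upper_triangular_mult:
  fixes A B :: "'a::semiring_0 mat"
  assumes "A \<in> carrier_mat n n" "B \<in> carrier_mat n n" "upper_triangular A" "upper_triangular B"
  shows "upper_triangular (A * B)"
  using band_mult[OF assms(1,2), of 0 0] assms
  by (simp add: band_0_iff band_0_iff[OF mult_carrier_mat[OF assms(1,2)]])

lemma upper_triangular_mult_diag: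
  fixes A B :: "'a::semiring_0 mat"
  assumes "A \<in> carrier_mat n n" "B \<in> carrier_mat n n" "upper_triangular A" "upper_triangular B" "i < n"
  shows "(A * B) $$ (i, i) = A $$ (i, i) * B $$ (i, i)"
proof -
  have "(A * B) $$ (i, i) = (\<Sum>l<n. A $$ (i, l) * B $$ (l, i))"
    using assms by (intro mult_mat_entry)
  also have "\<dots> = (\<Sum>l\<in>{i}. A $$ (i, l) * B $$ (l, i))"
  proof (rule sum.mono_neutral_right)
    show "\<forall>l\<in>{..<n} - {i}. A $$ (i, l) * B $$ (l, i) = 0"
    proof
      fix l assume "l \<in> {..<n} - {i}"
      then have "l < i \<or> i < l" "l < n" by auto
      then show "A $$ (i, l) * B $$ (l, i) = 0"
        using assms by (auto simp: upper_triangular_def)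
    qed
  qed (use assms in auto)
  finally show ?thesis by simp
qed

lemma upper_triangular_mult_superdiag:
  fixes A B :: "'a::semiring_0 mat"
  assumes "A \<in> carrier_mat n n" "B \<in> carrier_mat n n" "upper_triangular A" "upper_triangular B" "Suc i < n"
  shows "(A * B) $$ (i, Suc i) = A $$ (i, i) * B $$ (i, Suc i) + A $$ (i, Suc i) * B $$ (Suc i, Suc i)"
proof -
  have "(A * B) $$ (i, Suc i) = (\<Sum>l<n. A $$ (i, l) * B $$ (l, Suc i))"
    using assms by (intro mult_mat_entry) auto
  also have "\<dots> = (\<Sum>l\<in>{i, Suc i}. A $$ (i, l) * B $$ (l, Suc i))"
  proof (rule sum.mono_neutral_right)
    show "\<forall>l\<in>{..<n} - {i, Suc i}. A $$ (i, l) * B $$ (l, Suc i) = 0"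
    proof
      fix l assume "l \<in> {..<n} - {i, Suc i}"
      then have "l < i \<or> Suc i < l" "l < n" by auto
      then show "A $$ (i, l) * B $$ (l, Suc i) = 0"
        using assms by (auto simp: upper_triangular_def)
    qed
  qed (use assms in auto)
  finally show ?thesis by simp
qed

text \<open>Back substitution from the last row upwards. In the entry \<open>(i, j)\<close> of
  \<open>A * B\<close> with \<open>j < i\<close>, triangularity of \<open>A\<close> kills the terms
  \<open>l < i\<close> and the induction hypothesis those with \<open>l > i\<close>, so the diagonal
  entry of \<open>A\<close> times \<open>B $$ (i, j)\<close> is 0.\<close>

lemma upper_triangular_right_inverse:
  fixes A B :: "'a::idom mat"
  assumes A: "A \<in> carrier_mat n n" "upper_triangular A" "\<And>i. i < n \<Longrightarrow> A $$ (i, i) \<noteq> 0"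
    and B: "B \<in> carrier_mat n n" and AB: "A * B = 1\<^sub>m n"
  shows "upper_triangular B"
proof -
  have "B $$ (i, j) = 0" if "i < n" "j < i" for i j
    using that
  proof (induction "n - i" arbitrary: i rule: less_induct)
    case less
    have "0 = (A * B) $$ (i, j)"
      using less.prems AB by simp
    also have "\<dots> = (\<Sum>l<n. A $$ (i, l) * B $$ (l, j))"
      using less.prems A B by (intro mult_mat_entry) auto
    also have "\<dots> = (\<Sum>l\<in>{i}. A $$ (i, l) * B $$ (l, j))"
    proof (rule sum.mono_neutral_right)
      show "\<forall>l\<in>{..<n} - {i}. A $$ (i, l) * B $$ (l, j) = 0"
      proof
        fix l assume "l \<in> {..<n} - {i}"
        then have "l < i \<or> (n - l < n - i \<and> j < l)" "l < n" using less.prems by auto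
        then show "A $$ (i, l) * B $$ (l, j) = 0"
          using A less by (auto simp: upper_triangular_def)
      qed
    qed (use less.prems in auto)
    finally show ?case using A(3) less.prems by simp
  qed
  then show ?thesis using B by (auto simp: upper_triangular_def)
qed

text \<open>On the right a transvection adds a multiple of column \<open>i\<close> to column
  \<open>j\<close>, on the left a multiple of row \<open>j\<close> to row \<open>i\<close>.
  Cancelling the entry of \<open>A\<close> leaves the two added terms.\<close>

lemma addrow_mat_mult_comm_entries:
  fixes A :: "'a::comm_ring_1 mat"
  assumes "A \<in> carrier_mat n n" "i < n" "j < n" "a < n" "b < n"
    and "A * addrow_mat n r i j = addrow_mat n s i j * A"
  shows "(if b = j then r * A $$ (a, i) else 0) = (if a = i then s * A $$ (j, b) else 0)"
proof -
  have "addcol r j i A $$ (a, b) = addrow s i j A $$ (a, b)"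
    using assms(6) addcol_mat[OF assms(1,2), of r j] addrow_mat[OF assms(1,3), of s i] by simp
  then show ?thesis
    using assms(1-5) by (auto split: if_splits)
qed

section \<open>The Borel group\<close>

lemma comm_group_unit_group: "comm_group (unit_group :: 'a::idom monoid)"
proof (rule comm_groupI)
  fix x :: 'a assume "x \<in> carrier unit_group"
  then obtain y where "1 = x * y" by (auto simp: unit_group_def)
  then show "\<exists>y\<in>carrier unit_group. y \<otimes>\<^bsub>unit_group\<^esub> x = \<one>\<^bsub>unit_group\<^esub>"
    by (intro bexI[of _ y]) (auto simp: unit_group_def mult.commute dvd_def)
next
  fix x y :: 'a assume "x \<in> carrier unit_group" "y \<in> carrier unit_group"
  then show "x \<otimes>\<^bsub>unit_group\<^esub> y \<in> carrier unit_group"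
    using mult_dvd_mono[of x 1 y 1] by (simp add: unit_group_def)
qed (auto simp: unit_group_def mult_ac)

locale unit_subgroup =
  fixes D :: "'a::idom set"
  assumes subgroup_D: "subgroup D unit_group"
begin

abbreviation D_group :: "'a monoid" where
  "D_group \<equiv> unit_group\<lparr>carrier := D\<rparr>"

abbreviation uinv :: "'a \<Rightarrow> 'a" where
  "uinv \<equiv> m_inv unit_group"

lemma comm_group_D: "comm_group D_group"
  using comm_group.axioms(2)[OF comm_group_unit_group] subgroup.subgroup_is_group[OF subgroup_D]
  by (intro group.group_comm_groupI) (auto simp: unit_group_def mult.commute)

lemma D_one [simp]: "1 \<in> D"
  using subgroup.one_closed[OF subgroup_D] by (simp add: unit_group_def)

lemma D_mult [simp]: "x \<in> D \<Longrightarrow> y \<in> D \<Longrightarrow> x * y \<in> D"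
  using subgroup.m_closed[OF subgroup_D] by (simp add: unit_group_def)

lemma D_inv [simp]: "x \<in> D \<Longrightarrow> uinv x \<in> D"
  using subgroup.m_inv_closed[OF subgroup_D] by simp

lemma D_inv_mult [simp]: "x \<in> D \<Longrightarrow> uinv x * x = 1" "x \<in> D \<Longrightarrow> x * uinv x = 1"
  using subgroup.mem_carrier[OF subgroup_D, of x] group.l_inv[of unit_group x] group.r_inv[of unit_group x]
    comm_group.axioms(2)[OF comm_group_unit_group]
  by (auto simp: unit_group_def)

lemma D_nonzero: "x \<in> D \<Longrightarrow> x \<noteq> 0"
  by (metis D_inv_mult(1) mult_zero_right zero_neq_one)

lemma D_inv_mult_distrib: "x \<in> D \<Longrightarrow> y \<in> D \<Longrightarrow> uinv (x * y) = uinv x * uinv y"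
  using comm_group.inv_mult[OF comm_group_unit_group, of x y] subgroup.mem_carrier[OF subgroup_D]
  by (simp add: unit_group_def)

lemma D_inv_one [simp]: "uinv 1 = 1"
  using D_inv_mult(1)[OF D_one] by simp

lemma D_inv_unique: "x \<in> D \<Longrightarrow> x * y = 1 \<Longrightarrow> y = uinv x"
  by (metis D_inv_mult(1) mult.assoc mult.comm_neutral mult_1)

lemma D_prod: "(\<And>i. i < (n::nat) \<Longrightarrow> f i \<in> D) \<Longrightarrow> (\<Prod>i<n. f i) \<in> D"
  by (induction n) auto

text \<open>Invertibility is automatic: the determinant is the product of the diagonal entries and
  so lies in \<open>D\<close>, and the adjugate divided by it is an inverse.\<close>

lemma carrier_Borel:
  "carrier (Borel D n) = {A \<in> carrier_mat n n. upper_triangular A \<and> (\<forall>i<n. A $$ (i, i) \<in> D)}"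
proof -
  have "A \<in> carrier (GL n)"
    if A: "A \<in> carrier_mat n n" "upper_triangular A" "\<forall>i<n. A $$ (i, i) \<in> D" for A
  proof -
    have "det A = (\<Prod>j<n. A $$ (j, j))"
      using det_upper_triangular[OF A(2,1)] A(1)
      by (simp add: diag_mat_def prod.distinct_set_conv_list[symmetric] atLeast0LessThan)
    then have d: "det A \<in> D"
      using D_prod[of n "\<lambda>j. A $$ (j, j)"] A(3) by simp
    define B where "B = uinv (det A) \<cdot>\<^sub>m adj_mat A"
    note adj = adj_mat[OF A(1)]
    have "B \<in> carrier_mat n n"
      using adj(1) by (simp add: B_def)
    moreover have "A * B = 1\<^sub>m n"
      using adj A(1) d by (simp add: B_def mult_smult_distrib[of _ n n]) (auto intro!: eq_matI simp: mult.assoc[symmetric])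
    moreover have "B * A = 1\<^sub>m n"
      using adj A(1) d by (simp add: B_def mult_smult_assoc_mat[of _ n n]) (auto intro!: eq_matI simp: mult.assoc[symmetric])
    ultimately show ?thesis
      using A(1) by (auto simp: GL_def units_of_def Units_def ring_mat_simps)
  qed
  moreover have "A \<in> carrier_mat n n" if "A \<in> carrier (GL n)" for A :: "'a mat"
    using that by (auto simp: GL_def units_of_def Units_def ring_mat_simps)
  ultimately show ?thesis
    by (auto simp: Borel_def)
qed

lemma Borel_simps [simp]:
  "A \<otimes>\<^bsub>Borel D n\<^esub> B = A * B" "\<one>\<^bsub>Borel D n\<^esub> = 1\<^sub>m n"
  by (simp_all add: Borel_def GL_def units_of_def ring_mat_simps)

lemma BorelD:
  assumes "A \<in> carrier (Borel D n)"
  shows "A \<in> carrier_mat n n" "upper_triangular A" "i < n \<Longrightarrow> A $$ (i, i) \<in> D"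
  using assms by (auto simp: carrier_Borel)

lemma Borel_diag_mult:
  "A \<in> carrier (Borel D n) \<Longrightarrow> B \<in> carrier (Borel D n) \<Longrightarrow> i < n \<Longrightarrow>
    (A * B) $$ (i, i) = A $$ (i, i) * B $$ (i, i)"
  by (intro upper_triangular_mult_diag) (auto dest: BorelD)

lemma group_Borel: "group (Borel D n)"
proof (rule groupI)
  fix A B assume A: "A \<in> carrier (Borel D n)" and B: "B \<in> carrier (Borel D n)"
  note AD = BorelD[OF A] and BD = BorelD[OF B]
  show "A \<otimes>\<^bsub>Borel D n\<^esub> B \<in> carrier (Borel D n)"
    using AD BD Borel_diag_mult[OF A B] upper_triangular_mult[OF AD(1) BD(1) AD(2) BD(2)]
    by (auto simp: carrier_Borel)
next
  fix A B C assume "A \<in> carrier (Borel D n)" "B \<in> carrier (Borel D n)" "C \<in> carrier (Borel D n)"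
  then show "A \<otimes>\<^bsub>Borel D n\<^esub> B \<otimes>\<^bsub>Borel D n\<^esub> C = A \<otimes>\<^bsub>Borel D n\<^esub> (B \<otimes>\<^bsub>Borel D n\<^esub> C)"
    by (auto simp: carrier_Borel)
next
  fix A assume A: "A \<in> carrier (Borel D n)"
  note AD = BorelD[OF A]
  show "\<one>\<^bsub>Borel D n\<^esub> \<otimes>\<^bsub>Borel D n\<^esub> A = A"
    using AD by simp
  have "A \<in> Units (ring_mat TYPE('a) n ())"
    using A by (auto simp: Borel_def GL_def units_of_def)
  then obtain B where B: "B \<in> carrier_mat n n" "A * B = 1\<^sub>m n" "B * A = 1\<^sub>m n"
    by (auto simp: Units_def ring_mat_simps)
  \<comment> \<open>The inverse taken in the full matrix ring is triangular, and its diagonal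
    entries are inverses of elements of \<open>D\<close>, so it stays in the group.\<close>
  have tri: "upper_triangular B"
    using upper_triangular_right_inverse[OF AD(1,2) _ B(1,2)] AD(3) D_nonzero by blast
  have "B $$ (i, i) \<in> D" if "i < n" for i
  proof -
    have "A $$ (i, i) * B $$ (i, i) = 1"
      using upper_triangular_mult_diag[OF AD(1) B(1) AD(2) tri that] B(2) that by simp
    then have "B $$ (i, i) = uinv (A $$ (i, i))"
      by (rule D_inv_unique[OF AD(3)[OF that]])
    then show ?thesis
      using AD(3)[OF that] by simp
  qed
  then show "\<exists>B\<in>carrier (Borel D n). B \<otimes>\<^bsub>Borel D n\<^esub> A = \<one>\<^bsub>Borel D n\<^esub>"
    using B tri by (auto simp: carrier_Borel)
qed (auto simp: carrier_Borel)

lemma unitri_subset: "unitri n \<subseteq> carrier (Borel D n)"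
  by (auto simp: unitri_def carrier_Borel)

lemma mat_diag_Borel: "(\<And>i. i < n \<Longrightarrow> u i \<in> D) \<Longrightarrow> mat_diag n u \<in> carrier (Borel D n)"
  by (auto simp: mat_diag_def carrier_Borel)

lemma addrow_mat_unitri: "i < j \<Longrightarrow> addrow_mat n r i j \<in> unitri n"
  by (auto simp: unitri_def upper_triangular_def)

lemma corner_mat_eq: "n \<ge> 2 \<Longrightarrow> corner_mat n r = addrow_mat n r 0 (n - 1)"
  by (rule eq_matI) (auto simp: corner_mat_def)

definition diag_part :: "nat \<Rightarrow> 'a mat \<Rightarrow> 'a mat" where
  "diag_part n A = mat_diag n (\<lambda>i. A $$ (i, i))"

text \<open>The retraction onto diagonal matrices; \<open>unitri n\<close> is its kernel, which is
  how it is shown to be normal.\<close>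

lemma diag_part_hom: "diag_part n \<in> hom (Borel D n) (Borel D n)"
proof (rule homI)
  fix A B assume "A \<in> carrier (Borel D n)" "B \<in> carrier (Borel D n)"
  then show "diag_part n (A \<otimes>\<^bsub>Borel D n\<^esub> B) = diag_part n A \<otimes>\<^bsub>Borel D n\<^esub> diag_part n B"
    by (simp add: diag_part_def mat_diag_diag Borel_diag_mult) (auto simp: mat_diag_def Borel_diag_mult)
qed (auto simp: diag_part_def intro!: mat_diag_Borel dest: BorelD)

lemma kernel_diag_part: "kernel (Borel D n) (Borel D n) (diag_part n) = unitri n"
proof -
  have "diag_part n A = 1\<^sub>m n \<longleftrightarrow> (\<forall>i<n. A $$ (i, i) = 1)" for A
    by (auto simp: diag_part_def mat_diag_def mat_eq_iff)
  then show ?thesis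
    by (auto simp: kernel_def unitri_def carrier_Borel)
qed

lemma unitri_normal: "unitri n \<lhd> Borel D n"
proof -
  interpret group "Borel D n" by (rule group_Borel)
  interpret group_hom "Borel D n" "Borel D n" "diag_part n"
    by unfold_locales (rule diag_part_hom)
  show ?thesis using normal_kernel by (simp add: kernel_diag_part)
qed

lemma scalars_commute:
  assumes "A \<in> carrier (Borel D n)"
  shows "u \<cdot>\<^sub>m 1\<^sub>m n * A = u \<cdot>\<^sub>m A" "A * (u \<cdot>\<^sub>m 1\<^sub>m n) = u \<cdot>\<^sub>m A"
  using BorelD(1)[OF assms]
  by (simp_all add: mult_smult_assoc_mat[of _ n n] mult_smult_distrib[of _ n n _ n])

lemma scalars_normal: "scalars D n \<lhd> Borel D n"
proof -
  interpret group "Borel D n" by (rule group_Borel)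
  have sub: "scalars D n \<subseteq> carrier (Borel D n)"
    by (auto simp: scalars_def carrier_Borel)
  have smult: "u \<cdot>\<^sub>m 1\<^sub>m n * (v \<cdot>\<^sub>m 1\<^sub>m n) = (u * v) \<cdot>\<^sub>m (1\<^sub>m n :: 'a mat)" for u v
    by (subst mult_smult_assoc_mat[of _ n n _ n]) (auto intro!: eq_matI)
  have "subgroup (scalars D n) (Borel D n)"
  proof (rule subgroupI[OF sub])
    show "scalars D n \<noteq> {}" using D_one unfolding scalars_def by blast
  next
    fix A assume "A \<in> scalars D n"
    then obtain u where u: "u \<in> D" "A = u \<cdot>\<^sub>m 1\<^sub>m n" by (auto simp: scalars_def)
    have B: "uinv u \<cdot>\<^sub>m 1\<^sub>m n \<in> scalars D n"
      using u(1) by (auto simp: scalars_def)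
    have "inv\<^bsub>Borel D n\<^esub> A = uinv u \<cdot>\<^sub>m 1\<^sub>m n"
      using u \<open>A \<in> scalars D n\<close> B sub
      by (intro inv_equality) (auto simp: smult)
    then show "inv\<^bsub>Borel D n\<^esub> A \<in> scalars D n"
      using B by simp
  next
    fix A B assume "A \<in> scalars D n" "B \<in> scalars D n"
    then show "A \<otimes>\<^bsub>Borel D n\<^esub> B \<in> scalars D n"
      using smult by (force simp: scalars_def)
  qed
  then show ?thesis
  proof (rule normal_invI)
    fix A B assume A: "A \<in> carrier (Borel D n)" and B: "B \<in> scalars D n"
    then have "A * B = B * A"
      using scalars_commute[OF A] by (auto simp: scalars_def)
    then have "A \<otimes>\<^bsub>Borel D n\<^esub> B \<otimes>\<^bsub>Borel D n\<^esub> inv\<^bsub>Borel D n\<^esub> A =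
        B \<otimes>\<^bsub>Borel D n\<^esub> (A \<otimes>\<^bsub>Borel D n\<^esub> inv\<^bsub>Borel D n\<^esub> A)"
      using m_assoc[of B A "inv\<^bsub>Borel D n\<^esub> A"] A B sub by auto
    also have "\<dots> = B"
      unfolding r_inv[OF A] using BorelD(1)[of B n] B sub by auto
    finally show "A \<otimes>\<^bsub>Borel D n\<^esub> B \<otimes>\<^bsub>Borel D n\<^esub> inv\<^bsub>Borel D n\<^esub> A \<in> scalars D n"
      using B by simp
  qed
qed

section \<open>The unitriangular matrices as the left Engel elements\<close>

lemma unitriD:
  assumes "A \<in> unitri n"
  shows "A \<in> carrier_mat n n" "upper_triangular A" "i < n \<Longrightarrow> A $$ (i, i) = 1" "A \<in> carrier (Borel D n)"
  using assms unitri_subset by (auto simp: unitri_def)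

lemma band_unitri: "A \<in> unitri n \<Longrightarrow> band (Suc 0) (A - 1\<^sub>m n)"
  by (auto simp: band_def unitri_def upper_triangular_def less_Suc_eq)

text \<open>With \<open>M = y - 1\<close> and \<open>N = u - 1\<close> the commutator is
  \<open>w = (u y)^-1 (y u)\<close>, so \<open>w - 1 = (u y)^-1 (M N - N M)\<close>. Both products
  gain one superdiagonal from \<open>N\<close>, and the triangular factor in front loses
  none.\<close>

lemma commutator_band:
  assumes y: "y \<in> unitri n" "band k (y - 1\<^sub>m n)" and u: "u \<in> unitri n"
  defines "w \<equiv> inv\<^bsub>Borel D n\<^esub> y * inv\<^bsub>Borel D n\<^esub> u * y * u"
  shows "band (Suc k) (w - 1\<^sub>m n)"
proof -
  interpret G: group "Borel D n" by (rule group_Borel)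
  note yc = unitriD(4)[OF y(1)] and uc = unitriD(4)[OF u]
  have ym: "y \<in> carrier_mat n n" and um: "u \<in> carrier_mat n n"
    using unitriD(1) y(1) u by auto
  define p where "p = inv\<^bsub>Borel D n\<^esub> (u * y)"
  have uyc: "u * y \<in> carrier (Borel D n)" "y * u \<in> carrier (Borel D n)"
    using G.m_closed[OF uc yc] G.m_closed[OF yc uc] by simp_all
  have pc: "p \<in> carrier (Borel D n)"
    using uyc by (simp add: p_def)
  note pm = BorelD(1)[OF pc] and uym = BorelD(1)[OF uyc(1)] and yum = BorelD(1)[OF uyc(2)]
  have "p * (u * y) = 1\<^sub>m n"
    using G.l_inv[OF uyc(1)] by (simp add: p_def)
  moreover have "w = p * (y * u)"
    using G.inv_mult_group[OF uc yc] G.m_assoc[of p y u] pc yc uc by (simp add: w_def p_def)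
  ultimately have w: "w - 1\<^sub>m n = p * (y * u - u * y)"
    using mult_minus_distrib_mat[OF pm yum uym] by simp
  define M N where "M = y - 1\<^sub>m n" and "N = u - 1\<^sub>m n"
  have MN: "M \<in> carrier_mat n n" "N \<in> carrier_mat n n"
    using ym um by (auto simp: M_def N_def)
  have "y = M + 1\<^sub>m n" "u = N + 1\<^sub>m n"
    using ym um by (auto simp: M_def N_def intro!: eq_matI)
  then have "y * u = M * N + N + (M + 1\<^sub>m n)" "u * y = N * M + M + (N + 1\<^sub>m n)"
    using MN by (simp_all add: add_mult_distrib_mat[of _ n n _ _ n] mult_add_distrib_mat[of _ n n _ n])
  then have "y * u - u * y = M * N - N * M"
    using MN by (auto intro!: eq_matI)
  moreover have "band (Suc k) (M * N - N * M)"
    using band_mult[OF MN, of k 1] band_mult[OF MN(2,1), of 1 k] y(2) band_unitri[OF u] MN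
    by (intro band_minus[of _ n]) (auto simp: M_def N_def)
  ultimately have "band (Suc k) (y * u - u * y)"
    by simp
  moreover have "band 0 p"
    using BorelD(1,2)[OF pc] by (simp add: band_0_iff)
  ultimately have "band (0 + Suc k) (p * (y * u - u * y))"
    by (intro band_mult[OF pm minus_carrier_mat[OF uym]])
  then show ?thesis by (simp add: w)
qed

text \<open>By normality the first commutator is unitriangular whatever \<open>A\<close> is, and
  each later one gains a superdiagonal. The count starts at \<open>Suc k\<close> because step 0 is
  \<open>A\<close> itself.\<close>

lemma engel_unitri:
  assumes A: "A \<in> carrier (Borel D n)" and u: "u \<in> unitri n"
  shows "engel (Borel D n) A u (Suc k) \<in> unitri n \<and>
    band (Suc k) (engel (Borel D n) A u (Suc k) - 1\<^sub>m n)"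
proof (induction k)
  case 0
  have "engel (Borel D n) A u (Suc 0) \<in> unitri n"
    using normal.commutator_closed(2)[OF unitri_normal u A] by simp
  then show ?case
    using band_unitri by simp
next
  case (Suc k)
  then show ?case
    using commutator_band[OF _ _ u] normal.commutator_closed(1)[OF unitri_normal _ unitriD(4)[OF u]]
    by (subst (1 2) engel.simps(2)) simp
qed

lemma engel_unitri_eq_one:
  assumes "A \<in> carrier (Borel D n)" "u \<in> unitri n" "n > 0"
  shows "engel (Borel D n) A u n = 1\<^sub>m n"
proof -
  obtain k where k: "n = Suc k"
    using assms(3) gr0_implies_Suc by blast
  have B: "engel (Borel D n) A u n \<in> unitri n" "band n (engel (Borel D n) A u n - 1\<^sub>m n)"
    using engel_unitri[OF assms(1,2), of k] k by auto
  then show ?thesis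
    using unitriD[OF B(1)] by (intro eq_matI) (auto simp: band_def)
qed

text \<open>Compare the entries at \<open>(i, Suc i)\<close> in \<open>A v w = v A\<close>, where
  \<open>w\<close> is the commutator of \<open>v\<close> with \<open>A\<close>. The entry of
  \<open>A\<close> there cancels, and the entry of \<open>w\<close> times \<open>A $$ (i, i)\<close>
  equals that of \<open>v\<close> times the difference of the diagonal entries, a nonzero product in
  a domain.\<close>

lemma engel_nontrivial:
  assumes A: "A \<in> carrier (Borel D n)" and i: "Suc i < n" and ne: "A $$ (i, i) \<noteq> A $$ (Suc i, Suc i)"
  defines "y \<equiv> engel (Borel D n) (addrow_mat n 1 i (Suc i)) A"
  shows "y k \<in> unitri n \<and> y k $$ (i, Suc i) \<noteq> 0"
proof (induction k)
  case 0
  then show ?case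
    using i addrow_mat_unitri[of i "Suc i" n 1] by (simp add: y_def)
next
  case (Suc k)
  interpret G: group "Borel D n" by (rule group_Borel)
  define v w where "v = y k" and "w = y (Suc k)"
  have v: "v \<in> unitri n" "v $$ (i, Suc i) \<noteq> 0"
    using Suc.IH by (simp_all add: v_def)
  have w_eq: "w = inv\<^bsub>Borel D n\<^esub> v * inv\<^bsub>Borel D n\<^esub> A * v * A"
    by (simp add: v_def w_def y_def)
  then have w: "w \<in> unitri n"
    using normal.commutator_closed(1)[OF unitri_normal v(1) A] by simp
  note vc = unitriD(4)[OF v(1)] and wc = unitriD(4)[OF w]
  have Av: "A * v \<in> carrier (Borel D n)"
    using G.m_closed[OF A vc] by simp
  have "A \<otimes>\<^bsub>Borel D n\<^esub> v \<otimes>\<^bsub>Borel D n\<^esub> w = v \<otimes>\<^bsub>Borel D n\<^esub> A"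
    using G.mult_commutator[OF vc A] by (simp add: w_eq)
  then have "(A * v * w) $$ (i, Suc i) = (v * A) $$ (i, Suc i)"
    by simp
  moreover have "(A * v * w) $$ (i, Suc i) = (A * v) $$ (i, i) * w $$ (i, Suc i) + (A * v) $$ (i, Suc i)"
    using upper_triangular_mult_superdiag[OF BorelD(1)[OF Av] BorelD(1)[OF wc] BorelD(2)[OF Av] BorelD(2)[OF wc] i]
      unitriD(3)[OF w i] by simp
  moreover have "(A * v) $$ (i, Suc i) = A $$ (i, i) * v $$ (i, Suc i) + A $$ (i, Suc i)"
    using upper_triangular_mult_superdiag[OF BorelD(1)[OF A] BorelD(1)[OF vc] BorelD(2)[OF A] BorelD(2)[OF vc] i]
      unitriD(3)[OF v(1) i] by simp
  moreover have "(v * A) $$ (i, Suc i) = A $$ (i, Suc i) + v $$ (i, Suc i) * A $$ (Suc i, Suc i)"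
    using upper_triangular_mult_superdiag[OF BorelD(1)[OF vc] BorelD(1)[OF A] BorelD(2)[OF vc] BorelD(2)[OF A] i]
      unitriD(3)[OF v(1), of i] i by simp
  moreover have "(A * v) $$ (i, i) = A $$ (i, i)"
    using Borel_diag_mult[OF A vc, of i] unitriD(3)[OF v(1), of i] i by simp
  ultimately have "A $$ (i, i) * w $$ (i, Suc i) = v $$ (i, Suc i) * (A $$ (Suc i, Suc i) - A $$ (i, i))"
    by (simp add: algebra_simps)
  then have "w $$ (i, Suc i) \<noteq> 0"
    using v(2) ne by auto
  then show ?case using w by (simp add: w_def)
qed

section \<open>The projective group\<close>

lemma group_PBorel: "group (PBorel D n)"
  unfolding PBorel_def using normal.factorgroup_is_group[OF scalars_normal] .

lemma proj_class_hom: "proj_class D n \<in> hom (Borel D n) (PBorel D n)"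
  using normal.r_coset_hom_Mod[OF scalars_normal[of n]]
  by (simp add: PBorel_def proj_class_def[abs_def])

lemma carrier_PBorel: "carrier (PBorel D n) = proj_class D n ` carrier (Borel D n)"
  by (auto simp: PBorel_def proj_class_def carrier_FactGroup)

lemma proj_class_group_hom: "group_hom (Borel D n) (PBorel D n) (proj_class D n)"
  by (simp add: group_hom_def group_hom_axioms_def group_Borel group_PBorel proj_class_hom)

lemma proj_class_closed [simp]: "A \<in> carrier (Borel D n) \<Longrightarrow> proj_class D n A \<in> carrier (PBorel D n)"
  by (simp add: carrier_PBorel)

lemma proj_class_mult:
  "A \<in> carrier (Borel D n) \<Longrightarrow> B \<in> carrier (Borel D n) \<Longrightarrow>
    proj_class D n A \<otimes>\<^bsub>PBorel D n\<^esub> proj_class D n B = proj_class D n (A * B)"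
  using hom_mult[OF proj_class_hom, of A n B] by simp

lemma proj_class_eq_iff:
  assumes "A \<in> carrier (Borel D n)" "B \<in> carrier (Borel D n)"
  shows "proj_class D n A = proj_class D n B \<longleftrightarrow> (\<exists>u\<in>D. A = u \<cdot>\<^sub>m B)"
  using normal.r_coset_eq_iff[OF scalars_normal assms] scalars_commute[OF assms(2)]
  by (auto simp: proj_class_def scalars_def)

lemma one_PBorel: "\<one>\<^bsub>PBorel D n\<^esub> = proj_class D n (1\<^sub>m n)"
  using group_hom.hom_one[OF proj_class_group_hom] by simp

text \<open>A scalar relating two unitriangular matrices is 1, by the entry at
  \<open>(0, 0)\<close>. Thus \<open>unitri n\<close> embeds in the projective group.\<close>

lemma proj_class_unitri_eq_iff:
  assumes "A \<in> unitri n" "B \<in> unitri n" "n > 0"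
  shows "proj_class D n A = proj_class D n B \<longleftrightarrow> A = B"
proof
  assume "proj_class D n A = proj_class D n B"
  then obtain u where u: "u \<in> D" "A = u \<cdot>\<^sub>m B"
    using proj_class_eq_iff assms unitriD(4) by blast
  then have "u = 1"
    using unitriD(3)[OF assms(1,3)] unitriD(1)[OF assms(2)] unitriD(3)[OF assms(2,3)] assms(3) by simp
  then show "A = B"
    using u(2) unitriD(1)[OF assms(2)] by (auto intro!: eq_matI)
qed simp

text \<open>A left Engel class is tested against transvections at adjacent positions, which makes
  neighbouring diagonal entries equal. The diagonal is then a constant \<open>a\<close>, and
  removing this scalar leaves a unitriangular representative.\<close>

lemma left_engel_PBorel:
  assumes "n > 0"
  shows "left_engel (PBorel D n) = proj_unitri D n"
proof
  interpret pc: group_hom "Borel D n" "PBorel D n" "proj_class D n"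
    by (rule proj_class_group_hom)
  show "proj_unitri D n \<subseteq> left_engel (PBorel D n)"
  proof
    fix g assume "g \<in> proj_unitri D n"
    then obtain u where u: "u \<in> unitri n" "g = proj_class D n u"
      by (auto simp: proj_unitri_def)
    have "engel (PBorel D n) x g n = \<one>\<^bsub>PBorel D n\<^esub>" if x: "x \<in> carrier (PBorel D n)" for x
    proof -
      obtain A where "A \<in> carrier (Borel D n)" "x = proj_class D n A"
        using x by (auto simp: carrier_PBorel)
      then show ?thesis
        using engel_unitri_eq_one[of A n u] pc.hom_engel[of A u n] u unitriD(4) assms
        by (simp add: one_PBorel)
    qed
    then show "g \<in> left_engel (PBorel D n)"
      using u unitriD(4) by (auto simp: left_engel_def)
  qed
  show "left_engel (PBorel D n) \<subseteq> proj_unitri D n"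
  proof
    fix g assume g: "g \<in> left_engel (PBorel D n)"
    then obtain A where A: "A \<in> carrier (Borel D n)" "g = proj_class D n A"
      by (auto simp: left_engel_def carrier_PBorel)
    have adj: "A $$ (i, i) = A $$ (Suc i, Suc i)" if i: "Suc i < n" for i
    proof (rule ccontr)
      assume ne: "A $$ (i, i) \<noteq> A $$ (Suc i, Suc i)"
      define E :: "'a mat" where "E = addrow_mat n 1 i (Suc i)"
      have E: "E \<in> carrier (Borel D n)"
        unfolding E_def by (intro unitriD(4) addrow_mat_unitri) simp
      then obtain k where "engel (PBorel D n) (proj_class D n E) g k = \<one>\<^bsub>PBorel D n\<^esub>"
        using g proj_class_closed unfolding left_engel_def by blast
      then have "proj_class D n (engel (Borel D n) E A k) = proj_class D n (1\<^sub>m n)"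
        using pc.hom_engel[OF E A(1)] A(2) by (simp add: one_PBorel)
      moreover have "1\<^sub>m n \<in> unitri n"
        by (auto simp: unitri_def)
      \<comment> \<open>Triviality in the quotient gives only a scalar matrix, but the iterated
        commutator is unitriangular, so it is the identity.\<close>
      ultimately have "engel (Borel D n) E A k = 1\<^sub>m n"
        using engel_nontrivial[OF A(1) i ne, of k] proj_class_unitri_eq_iff assms by (auto simp: E_def)
      then show False
        using engel_nontrivial[OF A(1) i ne, of k] i by (simp add: E_def)
    qed
    define a where "a = A $$ (0, 0)"
    have diag: "A $$ (i, i) = a" if "i < n" for i
      using that adj unfolding a_def by (induction i) auto
    have a: "a \<in> D"
      using BorelD(3)[OF A(1) assms] by (simp add: a_def)
    have U: "uinv a \<cdot>\<^sub>m A \<in> unitri n"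
      using BorelD(1,2)[OF A(1)] diag a by (auto simp: unitri_def upper_triangular_def)
    have "A = a \<cdot>\<^sub>m (uinv a \<cdot>\<^sub>m A)"
      using a by (auto intro!: eq_matI simp: mult.assoc[symmetric])
    then have "proj_class D n A = proj_class D n (uinv a \<cdot>\<^sub>m A)"
      using proj_class_eq_iff[OF A(1) unitriD(4)[OF U]] a by blast
    then show "g \<in> proj_unitri D n"
      using A(2) U by (auto simp: proj_unitri_def)
  qed
qed

lemma auto_image_proj_unitri:
  "n > 0 \<Longrightarrow> \<phi> \<in> auto (PBorel D n) \<Longrightarrow> \<phi> ` proj_unitri D n = proj_unitri D n"
  using auto_image_left_engel[OF group_PBorel, of \<phi> n] by (simp add: left_engel_PBorel)

lemma corner_mat_unitri: "n \<ge> 2 \<Longrightarrow> corner_mat n r \<in> unitri n"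
  by (simp add: corner_mat_eq addrow_mat_unitri)

lemma corner_mat_Borel: "n \<ge> 2 \<Longrightarrow> corner_mat n r \<in> carrier (Borel D n)"
  using corner_mat_unitri unitriD(4) by blast

text \<open>The left product changes \<open>A\<close> only in the last column, by \<open>r\<close>
  times the first column, and the right one only in the first row, by \<open>s\<close> times the
  last row. In a triangular matrix that column and that row each have at most one nonzero entry, and
  both contributions sit in the corner.\<close>

lemma mult_corner_mat_eq_iff:
  assumes A: "A \<in> carrier (Borel D n)" and n: "n \<ge> 2"
  shows "A * corner_mat n r = corner_mat n s * A \<longleftrightarrow> A $$ (0, 0) * r = s * A $$ (n - 1, n - 1)"
proof -
  note Am = BorelD(1,2)[OF A]
  have zero: "A $$ (i, j) = 0" if "j < i" "i < n" for i j
    using Am that by (auto simp: upper_triangular_def)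
  have "A * corner_mat n r = addcol r (n - 1) 0 A"
    using addcol_mat[OF Am(1), of 0 r "n - 1"] n by (simp add: corner_mat_eq)
  moreover have "corner_mat n s * A = addrow s 0 (n - 1) A"
    using addrow_mat[OF Am(1), of "n - 1" s 0] n by (simp add: corner_mat_eq)
  moreover have "addcol r (n - 1) 0 A = addrow s 0 (n - 1) A \<longleftrightarrow>
      (\<forall>i<n. \<forall>j<n. (if j = n - 1 then r * A $$ (i, 0) else 0) = (if i = 0 then s * A $$ (n - 1, j) else 0))"
    using Am(1) by (auto simp: mat_eq_iff split: if_splits)
  moreover have "\<dots> \<longleftrightarrow> r * A $$ (0, 0) = s * A $$ (n - 1, n - 1)"
  proof
    assume eq: "\<forall>i<n. \<forall>j<n. (if j = n - 1 then r * A $$ (i, 0) else 0) = (if i = 0 then s * A $$ (n - 1, j) else 0)"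
    then show "r * A $$ (0, 0) = s * A $$ (n - 1, n - 1)"
      using eq[rule_format, of 0 "n - 1"] n by simp
  next
    assume "r * A $$ (0, 0) = s * A $$ (n - 1, n - 1)"
    then show "\<forall>i<n. \<forall>j<n. (if j = n - 1 then r * A $$ (i, 0) else 0) = (if i = 0 then s * A $$ (n - 1, j) else 0)"
      using zero n by auto
  qed
  ultimately show ?thesis by (simp add: mult.commute)
qed

lemma corner_mat_mult:
  assumes "n \<ge> 2"
  shows "corner_mat n r * corner_mat n s = corner_mat n (r + s)"
proof -
  have "corner_mat n r * corner_mat n s = addrow r 0 (n - 1) (corner_mat n s)"
    using addrow_mat[of "corner_mat n s" n n "n - 1" r 0] assms
    by (simp add: corner_mat_eq[of n r] corner_mat_def[of n s])
  also have "\<dots> = corner_mat n (r + s)"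
    using assms by (intro eq_matI) (auto simp: corner_mat_def)
  finally show ?thesis .
qed

lemma corner_mat_inj:
  assumes "n \<ge> 2" "corner_mat n r = corner_mat n s"
  shows "r = s"
proof -
  have "corner_mat n r $$ (0, n - 1) = corner_mat n s $$ (0, n - 1)"
    by (simp only: assms(2))
  then show ?thesis
    using assms(1) by (simp add: corner_mat_def)
qed

lemma proj_class_corner_eq_iff:
  "n \<ge> 2 \<Longrightarrow> proj_class D n (corner_mat n r) = proj_class D n (corner_mat n s) \<longleftrightarrow> r = s"
  using proj_class_unitri_eq_iff[OF corner_mat_unitri corner_mat_unitri, of n r s] corner_mat_inj by auto

text \<open>An entry \<open>(a, b)\<close> above the diagonal is moved alone into another place by
  the transvection at \<open>(b, n - 1)\<close> if \<open>b < n - 1\<close>, or at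
  \<open>(0, a)\<close> if \<open>a > 0\<close>; only the corner escapes both. The result gives the
  center of \<open>unitri n\<close> as well as that of \<open>Borel D n\<close>.\<close>

lemma commute_transvections_entries:
  assumes A: "A \<in> carrier (Borel D n)"
    and comm: "\<And>i j. i < j \<Longrightarrow> j < n \<Longrightarrow> A * addrow_mat n 1 i j = addrow_mat n 1 i j * A"
    and ab: "a < n" "b < n"
  shows "A $$ (a, b) = (if a = b then A $$ (0, 0) else if a = 0 \<and> b = n - 1 then A $$ (0, n - 1) else 0)"
proof -
  have entry: "(if y = j then A $$ (x, i) else 0) = (if x = i then A $$ (j, y) else 0)"
    if "i < j" "j < n" "x < n" "y < n" for i j x y
    using addrow_mat_mult_comm_entries[OF BorelD(1)[OF A], of i j x y 1 1] comm[OF that(1,2)] that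
    unfolding mult_1_left by simp
  consider "a = b" | "b < a" | "a < b" "b < n - 1" | "0 < a" "a < b" "b = n - 1" | "a = 0" "b = n - 1"
    using ab by linarith
  then show ?thesis
  proof cases
    case 1
    then show ?thesis using entry[of 0 a 0 a] ab by (cases "a = 0") auto
  next
    case 2
    then show ?thesis using BorelD(1,2)[OF A] ab by (auto simp: upper_triangular_def)
  next
    case 3
    then show ?thesis using entry[of b "n - 1" a "n - 1"] ab by auto
  next
    case 4
    then show ?thesis using entry[of 0 a 0 b] ab by auto
  qed auto
qed

text \<open>Presents the corner subgroup as the center of \<open>proj_unitri D n\<close>, in terms
  that every automorphism respects.\<close>

lemma unitri_centralizer:
  assumes n: "n \<ge> 2"
  shows "proj_unitri D n \<inter> centralizer (PBorel D n) (proj_unitri D n) =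
    range (\<lambda>r. proj_class D n (corner_mat n r))"
proof (intro equalityI subsetI)
  fix x assume x: "x \<in> proj_unitri D n \<inter> centralizer (PBorel D n) (proj_unitri D n)"
  then obtain A where A: "A \<in> unitri n" "x = proj_class D n A"
    by (auto simp: proj_unitri_def)
  note Ac = unitriD(4)[OF A(1)]
  have comm: "A * addrow_mat n 1 i j = addrow_mat n 1 i j * A" if ij: "i < j" "j < n" for i j
  proof -
    define E :: "'a mat" where "E = addrow_mat n 1 i j"
    have E: "E \<in> unitri n"
      unfolding E_def by (rule addrow_mat_unitri[OF ij(1)])
    then have "x \<otimes>\<^bsub>PBorel D n\<^esub> proj_class D n E = proj_class D n E \<otimes>\<^bsub>PBorel D n\<^esub> x"
      using x by (auto simp: centralizer_def proj_unitri_def)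
    then have "proj_class D n (A * E) = proj_class D n (E * A)"
      using A(2) Ac unitriD(4)[OF E] by (simp add: proj_class_mult)
    moreover have "A * E \<in> unitri n" "E * A \<in> unitri n"
      using subgroup.m_closed[OF normal_imp_subgroup[OF unitri_normal]] A(1) E by fastforce+
    ultimately show ?thesis
      using proj_class_unitri_eq_iff n by (simp add: E_def)
  qed
  define r where "r = A $$ (0, n - 1)"
  have "A $$ (a, b) = (if a = b then 1 else if a = 0 \<and> b = n - 1 then r else 0)" if "a < n" "b < n" for a b
    using commute_transvections_entries[OF Ac comm that] unitriD(3)[OF A(1), of 0] n by (simp add: r_def)
  then have "A = corner_mat n r"
    using unitriD(1)[OF A(1)] by (intro eq_matI) (auto simp: corner_mat_def)
  then show "x \<in> range (\<lambda>r. proj_class D n (corner_mat n r))"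
    using A(2) by auto
next
  fix x assume "x \<in> range (\<lambda>r. proj_class D n (corner_mat n r))"
  then obtain r where r: "x = proj_class D n (corner_mat n r)" by auto
  have "x \<otimes>\<^bsub>PBorel D n\<^esub> y = y \<otimes>\<^bsub>PBorel D n\<^esub> x" if y: "y \<in> proj_unitri D n" for y
  proof -
    obtain A where A: "A \<in> unitri n" "y = proj_class D n A"
      using y by (auto simp: proj_unitri_def)
    have "A * corner_mat n r = corner_mat n r * A"
      using mult_corner_mat_eq_iff[OF unitriD(4)[OF A(1)] n, of r r] unitriD(3)[OF A(1)] n by simp
    then show ?thesis
      using A r n unitriD(4)[OF A(1)] by (simp add: proj_class_mult corner_mat_Borel)
  qed
  then show "x \<in> proj_unitri D n \<inter> centralizer (PBorel D n) (proj_unitri D n)"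
    using r imageI[OF corner_mat_unitri[OF n, of r]] corner_mat_Borel[OF n]
    by (auto simp: centralizer_def proj_unitri_def)
qed

lemma proj_unitri_subset: "proj_unitri D n \<subseteq> carrier (PBorel D n)"
  using unitriD(4) by (auto simp: proj_unitri_def)

lemma proj_unitri_normal: "proj_unitri D n \<lhd> PBorel D n"
  unfolding proj_unitri_def
  by (intro normal_image_surj[OF unitri_normal group_PBorel proj_class_hom] carrier_PBorel[symmetric])

lemma auto_corner:
  assumes \<phi>: "\<phi> \<in> auto (PBorel D n)" and n: "n \<ge> 2"
  obtains \<alpha> where "bij \<alpha>" "\<And>r s. \<alpha> (r + s) = \<alpha> r + \<alpha> s"
    "\<And>r. \<phi> (proj_class D n (corner_mat n r)) = proj_class D n (corner_mat n (\<alpha> r))"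
proof -
  define c where "c r = proj_class D n (corner_mat n r)" for r
  have c: "c r \<in> carrier (PBorel D n)" "c r = c s \<longleftrightarrow> r = s" "c r \<otimes>\<^bsub>PBorel D n\<^esub> c s = c (r + s)" for r s
    using n by (simp_all add: c_def corner_mat_Borel proj_class_corner_eq_iff proj_class_mult corner_mat_mult)
  have U: "\<phi> ` proj_unitri D n = proj_unitri D n"
    using auto_image_proj_unitri \<phi> n by simp
  \<comment> \<open>Injectivity of \<phi> is what allows the image to be taken through the
    intersection.\<close>
  have "\<phi> ` (proj_unitri D n \<inter> centralizer (PBorel D n) (proj_unitri D n)) =
      \<phi> ` proj_unitri D n \<inter> \<phi> ` centralizer (PBorel D n) (proj_unitri D n)"
    using auto_bij[OF \<phi>] proj_unitri_subset
    by (intro inj_on_image_Int[of _ "carrier (PBorel D n)"]) (auto simp: bij_betw_def centralizer_def)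
  then have img: "\<phi> ` range c = range c"
    using auto_image_centralizer[OF group_PBorel \<phi> proj_unitri_subset U] U
    by (simp add: unitri_centralizer[OF n] c_def[abs_def])
  then have "\<forall>r. \<exists>s. \<phi> (c r) = c s"
    by (metis (no_types, lifting) imageE rangeI image_eqI)
  then obtain \<alpha> where \<alpha>: "\<And>r. \<phi> (c r) = c (\<alpha> r)"
    by metis
  show ?thesis
  proof
    show "bij \<alpha>"
    proof (rule bijI)
      show "inj \<alpha>"
        using \<alpha> c auto_eq_iff[OF \<phi>] by (metis injI)
      show "surj \<alpha>"
      proof (unfold surj_def, rule allI)
        fix s
        obtain r where "c s = \<phi> (c r)"
          using img by (metis (no_types, lifting) imageE rangeI)
        then show "\<exists>r. s = \<alpha> r"
          using \<alpha> c(2) by auto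
      qed
    qed
    fix r s
    have "c (\<alpha> (r + s)) = \<phi> (c r \<otimes>\<^bsub>PBorel D n\<^esub> c s)"
      by (simp add: \<alpha> c)
    also have "\<dots> = c (\<alpha> r + \<alpha> s)"
      using hom_mult[OF auto_hom[OF \<phi>] c(1) c(1)] by (simp add: \<alpha> c)
    finally show "\<alpha> (r + s) = \<alpha> r + \<alpha> s"
      by (simp add: c)
    show "\<phi> (proj_class D n (corner_mat n r)) = proj_class D n (corner_mat n (\<alpha> r))"
      using \<alpha> by (simp add: c_def)
  qed
qed

section \<open>The ratio of the corner entries\<close>

definition corner_quot :: "nat \<Rightarrow> 'a mat \<Rightarrow> 'a" where
  "corner_quot n A = A $$ (0, 0) * uinv (A $$ (n - 1, n - 1))"

text \<open>\<open>the_elem\<close> is meaningful on projective classes because a scalar factor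
  cancels in the ratio, so the image is a singleton.\<close>

definition proj_quot :: "nat \<Rightarrow> 'a mat set \<Rightarrow> 'a" where
  "proj_quot n X = the_elem (corner_quot n ` X)"

lemma corner_quot_closed: "A \<in> carrier (Borel D n) \<Longrightarrow> n > 0 \<Longrightarrow> corner_quot n A \<in> D"
  by (simp add: corner_quot_def BorelD(3))

lemma corner_quot_mult:
  assumes "A \<in> carrier (Borel D n)" "B \<in> carrier (Borel D n)" "n > 0"
  shows "corner_quot n (A * B) = corner_quot n A * corner_quot n B"
  using assms by (simp add: corner_quot_def Borel_diag_mult D_inv_mult_distrib BorelD(3))

lemma proj_quot_proj_class:
  assumes A: "A \<in> carrier (Borel D n)" and n: "n > 0"
  shows "proj_quot n (proj_class D n A) = corner_quot n A"
proof -
  have "corner_quot n (u \<cdot>\<^sub>m 1\<^sub>m n * A) = corner_quot n A" if u: "u \<in> D" for u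
  proof -
    have "u * x * (uinv u * y) = u * uinv u * (x * y)" for x y
      by (simp add: mult_ac del: D_inv_mult)
    then show ?thesis
      using BorelD(1)[OF A] BorelD(3)[OF A] u n scalars_commute(1)[OF A, of u]
      by (simp add: corner_quot_def D_inv_mult_distrib)
  qed
  then have "(\<lambda>u. corner_quot n (u \<cdot>\<^sub>m 1\<^sub>m n * A)) ` D = (\<lambda>u. corner_quot n A) ` D"
    by (intro image_cong) auto
  also have "\<dots> = {corner_quot n A}"
    using D_one by blast
  finally have "(\<lambda>u. corner_quot n (u \<cdot>\<^sub>m 1\<^sub>m n * A)) ` D = {corner_quot n A}" .
  moreover have "proj_class D n A = (\<lambda>u. u \<cdot>\<^sub>m 1\<^sub>m n * A) ` D"
    by (auto simp: proj_class_def r_coset_def scalars_def)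
  ultimately have "corner_quot n ` proj_class D n A = {corner_quot n A}"
    by (simp add: image_image)
  then show ?thesis by (simp add: proj_quot_def)
qed

lemma proj_quot_closed: "n > 0 \<Longrightarrow> x \<in> carrier (PBorel D n) \<Longrightarrow> proj_quot n x \<in> D"
  by (auto simp: carrier_PBorel proj_quot_proj_class corner_quot_closed)

lemma proj_quot_hom:
  assumes n: "n > 0"
  shows "proj_quot n \<in> hom (PBorel D n) D_group"
proof (rule homI)
  fix x y assume "x \<in> carrier (PBorel D n)" "y \<in> carrier (PBorel D n)"
  then obtain A B where AB: "A \<in> carrier (Borel D n)" "x = proj_class D n A"
    "B \<in> carrier (Borel D n)" "y = proj_class D n B"
    by (auto simp: carrier_PBorel)
  have "A * B \<in> carrier (Borel D n)"
    using monoid.m_closed[OF group.is_monoid[OF group_Borel] AB(1,3)] by simp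
  then show "proj_quot n (x \<otimes>\<^bsub>PBorel D n\<^esub> y) = proj_quot n x \<otimes>\<^bsub>D_group\<^esub> proj_quot n y"
    using AB n by (simp add: proj_class_mult proj_quot_proj_class corner_quot_mult unit_group_def)
qed (use proj_quot_closed[OF n] in simp)

lemma proj_quot_surj:
  assumes "n \<ge> 2"
  shows "proj_quot n ` carrier (PBorel D n) = D"
proof
  show "D \<subseteq> proj_quot n ` carrier (PBorel D n)"
  proof
    fix u assume u: "u \<in> D"
    define A where "A = mat_diag n (\<lambda>i. if i = 0 then u else 1)"
    have A: "A \<in> carrier (Borel D n)"
      unfolding A_def using u by (intro mat_diag_Borel) auto
    have "corner_quot n A = u"
      using assms by (simp add: corner_quot_def A_def mat_diag_def)
    then show "u \<in> proj_quot n ` carrier (PBorel D n)"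
      using A assms proj_quot_proj_class[OF A] by (force simp: carrier_PBorel)
  qed
qed (use assms proj_quot_closed in auto)

lemma D_cross_mult:
  assumes "b \<in> D"
  shows "a * r = s * b \<longleftrightarrow> s = a * uinv b * r"
proof
  assume eq: "a * r = s * b"
  have "s = s * b * uinv b"
    using assms by (simp add: mult.assoc)
  also have "\<dots> = a * uinv b * r"
    unfolding eq[symmetric] by (simp only: mult_ac)
  finally show "s = a * uinv b * r" .
next
  assume eq: "s = a * uinv b * r"
  have "s * b = a * r * (uinv b * b)"
    unfolding eq by (simp only: mult_ac)
  then show "a * r = s * b"
    using assms by simp
qed

text \<open>Equality of classes permits a scalar, but multiplying by a corner matrix leaves the
  entry at \<open>(0, 0)\<close> unchanged, so the scalar is 1 and the matrix identity applies. The
  ratio is thereby expressed through the group operation.\<close>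

lemma proj_quot_conj_corner:
  assumes x: "x \<in> carrier (PBorel D n)" and n: "n \<ge> 2"
  shows "x \<otimes>\<^bsub>PBorel D n\<^esub> proj_class D n (corner_mat n r) =
    proj_class D n (corner_mat n s) \<otimes>\<^bsub>PBorel D n\<^esub> x \<longleftrightarrow> s = proj_quot n x * r"
proof -
  obtain A where A: "A \<in> carrier (Borel D n)" "x = proj_class D n A"
    using x by (auto simp: carrier_PBorel)
  interpret G: group "Borel D n" by (rule group_Borel)
  note cc = corner_mat_Borel[OF n]
  have closed: "A * corner_mat n r \<in> carrier (Borel D n)" "corner_mat n s * A \<in> carrier (Borel D n)"
    using G.m_closed[OF A(1) cc] G.m_closed[OF cc A(1)] by simp_all
  have diag: "(A * corner_mat n r) $$ (0, 0) = A $$ (0, 0)" "(corner_mat n s * A) $$ (0, 0) = A $$ (0, 0)"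
    using Borel_diag_mult[OF A(1) cc] Borel_diag_mult[OF cc A(1)] n by (simp_all add: corner_mat_def)
  have D0: "A $$ (0, 0) \<in> D" "A $$ (n - 1, n - 1) \<in> D"
    using BorelD(3)[OF A(1)] n by auto
  have "x \<otimes>\<^bsub>PBorel D n\<^esub> proj_class D n (corner_mat n r) =
      proj_class D n (corner_mat n s) \<otimes>\<^bsub>PBorel D n\<^esub> x \<longleftrightarrow>
      (\<exists>u\<in>D. A * corner_mat n r = u \<cdot>\<^sub>m (corner_mat n s * A))"
    using A cc closed by (simp add: proj_class_mult proj_class_eq_iff)
  also have "\<dots> \<longleftrightarrow> A * corner_mat n r = corner_mat n s * A"
  proof
    assume "\<exists>u\<in>D. A * corner_mat n r = u \<cdot>\<^sub>m (corner_mat n s * A)"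
    then obtain u where u: "u \<in> D" "A * corner_mat n r = u \<cdot>\<^sub>m (corner_mat n s * A)" by auto
    have "(u \<cdot>\<^sub>m (corner_mat n s * A)) $$ (0, 0) = u * A $$ (0, 0)"
      using diag(2) carrier_matD[OF BorelD(1)[OF closed(2)]] n by (subst index_smult_mat(1)) auto
    then have "A $$ (0, 0) = u * A $$ (0, 0)"
      using diag(1) unfolding u(2) by simp
    then have "u = 1"
      using D_nonzero[OF D0(1)] by simp
    then show "A * corner_mat n r = corner_mat n s * A"
      using u(2) BorelD(1)[OF closed(2)] by (auto intro!: eq_matI)
  next
    assume "A * corner_mat n r = corner_mat n s * A"
    then show "\<exists>u\<in>D. A * corner_mat n r = u \<cdot>\<^sub>m (corner_mat n s * A)"
      using BorelD(1)[OF closed(2)] by (intro bexI[of _ 1]) (auto intro!: eq_matI)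
  qed
  also have "\<dots> \<longleftrightarrow> A $$ (0, 0) * r = s * A $$ (n - 1, n - 1)"
    by (rule mult_corner_mat_eq_iff[OF A(1) n])
  also have "\<dots> \<longleftrightarrow> s = corner_quot n A * r"
    unfolding corner_quot_def by (rule D_cross_mult[OF D0(2)])
  finally show ?thesis
    using A n by (simp add: proj_quot_proj_class)
qed

text \<open>Applying \<phi> to the conjugation relation shows that \<alpha> turns multiplication by
  the ratio of \<open>x\<close> into multiplication by the ratio of \<open>\<phi> x\<close>. The
  latter ratio hence depends only on the former, and \<beta> is the resulting map.\<close>

lemma auto_proj_quot:
  assumes \<phi>: "\<phi> \<in> auto (PBorel D n)" and n: "n \<ge> 2"
    and \<alpha>: "bij \<alpha>" "\<And>r. \<phi> (proj_class D n (corner_mat n r)) = proj_class D n (corner_mat n (\<alpha> r))"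
  obtains \<beta> where "\<beta> \<in> auto D_group" "\<And>x. x \<in> carrier (PBorel D n) \<Longrightarrow> \<beta> (proj_quot n x) = proj_quot n (\<phi> x)"
    "\<And>u r. u \<in> D \<Longrightarrow> \<alpha> (u * r) = \<beta> u * \<alpha> r"
proof -
  have \<alpha>_mult: "\<alpha> (proj_quot n x * r) = proj_quot n (\<phi> x) * \<alpha> r" if x: "x \<in> carrier (PBorel D n)" for x r
  proof -
    define c where "c r = proj_class D n (corner_mat n r)" for r
    have c: "c r \<in> carrier (PBorel D n)" for r
      using n corner_mat_Borel by (simp add: c_def)
    have "x \<otimes>\<^bsub>PBorel D n\<^esub> c r = c (proj_quot n x * r) \<otimes>\<^bsub>PBorel D n\<^esub> x"
      using proj_quot_conj_corner[OF x n] by (simp add: c_def)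
    then have "\<phi> (x \<otimes>\<^bsub>PBorel D n\<^esub> c r) = \<phi> (c (proj_quot n x * r) \<otimes>\<^bsub>PBorel D n\<^esub> x)"
      by simp
    then have "\<phi> x \<otimes>\<^bsub>PBorel D n\<^esub> c (\<alpha> r) = c (\<alpha> (proj_quot n x * r)) \<otimes>\<^bsub>PBorel D n\<^esub> \<phi> x"
      using hom_mult[OF auto_hom[OF \<phi>] x c] hom_mult[OF auto_hom[OF \<phi>] c x] \<alpha>(2) by (simp add: c_def)
    then show ?thesis
      using proj_quot_conj_corner[OF auto_closed[OF \<phi> x] n] by (simp add: c_def)
  qed
  \<comment> \<open>Evaluating at the preimage of 1 isolates the multiplier:
    \<open>\<alpha> (u * r0) = \<beta> u * 1\<close>.\<close>
  obtain r0 where r0: "\<alpha> r0 = 1"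
    using \<alpha>(1) by (metis bij_pointE)
  define \<beta> where "\<beta> = restrict (\<lambda>u. \<alpha> (u * r0)) D"
  have \<beta>: "\<beta> (proj_quot n x) = proj_quot n (\<phi> x)" if "x \<in> carrier (PBorel D n)" for x
    using \<alpha>_mult[OF that, of r0] r0 proj_quot_closed[OF _ that] n by (simp add: \<beta>_def)
  have "\<exists>x\<in>carrier (PBorel D n). u = proj_quot n x" if "u \<in> D" for u
    using that proj_quot_surj[OF n] by (metis imageE)
  note surj = this
  have mult: "\<alpha> (u * r) = \<beta> u * \<alpha> r" if "u \<in> D" for u r
    using surj[OF that] \<alpha>_mult \<beta> by auto
  have \<beta>D: "\<beta> u \<in> D" if "u \<in> D" for u
    using surj[OF that] \<beta> n auto_closed[OF \<phi>] by (auto intro!: proj_quot_closed)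
  have "\<beta> \<in> hom D_group D_group"
  proof (rule homI)
    fix u v assume "u \<in> carrier D_group" "v \<in> carrier D_group"
    then have uv: "u \<in> D" "v \<in> D" by simp_all
    have "\<beta> (u * v) = \<alpha> (u * (v * r0))"
      using uv by (simp add: \<beta>_def mult.assoc)
    also have "\<dots> = \<beta> u * \<beta> v"
      unfolding mult[OF uv(1)] using uv(2) by (simp add: \<beta>_def)
    finally show "\<beta> (u \<otimes>\<^bsub>D_group\<^esub> v) = \<beta> u \<otimes>\<^bsub>D_group\<^esub> \<beta> v"
      by (simp add: unit_group_def)
  qed (use \<beta>D in simp)
  moreover have "inj_on \<beta> D"
  proof (rule inj_onI)
    fix u v assume uv: "u \<in> D" "v \<in> D" "\<beta> u = \<beta> v"
    \<comment> \<open>Both sides are \<open>\<beta> u * \<alpha> 1\<close>, so injectivity is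
      inherited from \<alpha>.\<close>
    then have "\<alpha> (u * 1) = \<alpha> (v * 1)"
      by (simp only: mult)
    then show "u = v"
      using \<alpha>(1) by (simp add: bij_def inj_eq)
  qed
  moreover have "\<beta> ` D = D"
  proof -
    have "\<beta> ` proj_quot n ` carrier (PBorel D n) = proj_quot n ` \<phi> ` carrier (PBorel D n)"
      unfolding image_image using \<beta> by (intro image_cong) auto
    moreover have "\<phi> ` carrier (PBorel D n) = carrier (PBorel D n)"
      using auto_bij[OF \<phi>] by (simp add: bij_betw_def)
    ultimately show ?thesis
      by (simp add: proj_quot_surj[OF n])
  qed
  ultimately have "\<beta> \<in> auto D_group"
    by (simp add: auto_iff bij_betw_def) (simp add: \<beta>_def)
  then show ?thesis
    using that \<beta> mult by blast
qed

section \<open>The diagonal part\<close>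

lemma group_PBorel_diag: "group (PBorel_diag D n)"
  unfolding PBorel_diag_def by (rule normal.factorgroup_is_group[OF proj_unitri_normal])

definition diag_proj :: "nat \<Rightarrow> 'a mat set \<Rightarrow> 'a mat set set" where
  "diag_proj n x = proj_unitri D n #>\<^bsub>PBorel D n\<^esub> x"

lemma diag_proj_hom: "diag_proj n \<in> hom (PBorel D n) (PBorel_diag D n)"
  unfolding PBorel_diag_def diag_proj_def[abs_def] by (rule normal.r_coset_hom_Mod[OF proj_unitri_normal])

lemma carrier_PBorel_diag: "carrier (PBorel_diag D n) = diag_proj n ` carrier (PBorel D n)"
  by (simp add: PBorel_diag_def diag_proj_def[abs_def] carrier_FactGroup)

lemma proj_quot_unitri:
  assumes "x \<in> proj_unitri D n" "n > 0"
  shows "proj_quot n x = 1"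
proof -
  obtain A where A: "A \<in> unitri n" "x = proj_class D n A"
    using assms(1) by (auto simp: proj_unitri_def)
  then show ?thesis
    using proj_quot_proj_class[OF unitriD(4)[OF A(1)] assms(2)] unitriD(3)[OF A(1)] assms(2)
    by (simp add: corner_quot_def)
qed

text \<open>Write \<open>A = (A T^-1) T\<close> with \<open>T\<close> the diagonal part of
  \<open>A\<close>; the first factor is unitriangular and disappears in the quotient.\<close>

lemma diag_proj_proj_class:
  assumes A: "A \<in> carrier (Borel D n)"
  shows "diag_proj n (proj_class D n A) = diag_class D n (\<lambda>i. A $$ (i, i))"
proof -
  interpret G: group "Borel D n" by (rule group_Borel)
  interpret dp: group_hom "Borel D n" "Borel D n" "diag_part n"
    by unfold_locales (rule diag_part_hom)
  define T where "T = diag_part n A"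
  have T: "T \<in> carrier (Borel D n)"
    using A by (simp add: T_def)
  have "diag_part n T = T"
    by (auto simp: T_def diag_part_def mat_diag_def)
  then have "diag_part n (A \<otimes>\<^bsub>Borel D n\<^esub> inv\<^bsub>Borel D n\<^esub> T) = T \<otimes>\<^bsub>Borel D n\<^esub> inv\<^bsub>Borel D n\<^esub> T"
    unfolding dp.hom_mult[OF A G.inv_closed[OF T]] dp.hom_inv[OF T] by (simp add: T_def)
  then have "A * inv\<^bsub>Borel D n\<^esub> T \<in> unitri n"
    using G.m_closed[OF A G.inv_closed[OF T]] G.r_inv[OF T] kernel_diag_part[of n] by (auto simp: kernel_def)
  note U = this
  have "A * inv\<^bsub>Borel D n\<^esub> T * T = A"
    using G.inv_solve_right'[of A A T] G.m_assoc[OF A G.inv_closed[OF T] T] G.l_inv[OF T] BorelD(1)[OF A] by simp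
  then have "proj_class D n A = proj_class D n (A * inv\<^bsub>Borel D n\<^esub> T) \<otimes>\<^bsub>PBorel D n\<^esub> proj_class D n T"
    using unitriD(4)[OF U] T by (simp add: proj_class_mult)
  then have "diag_proj n (proj_class D n A) = diag_proj n (proj_class D n T)"
    unfolding diag_proj_def
      normal.r_coset_eq_iff[OF proj_unitri_normal proj_class_closed[OF A] proj_class_closed[OF T]]
    using U by (auto simp: proj_unitri_def)
  then show ?thesis
    by (simp add: diag_proj_def diag_class_def T_def diag_part_def)
qed

lemma diag_class_eq: "diag_class D n u = diag_proj n (proj_class D n (mat_diag n u))"
  by (simp add: diag_class_def diag_proj_def)

lemma proj_quot_mat_diag:
  "n > 0 \<Longrightarrow> (\<And>i. i < n \<Longrightarrow> u i \<in> D) \<Longrightarrow>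
    proj_quot n (proj_class D n (mat_diag n u)) = u 0 * uinv (u (n - 1))"
  by (simp add: proj_quot_proj_class mat_diag_Borel corner_quot_def) (simp add: mat_diag_def)

text \<open>Recognizes the subgroup as the image of the kernel of \<open>proj_quot\<close>, from
  which its normality and its invariance are deduced.\<close>

lemma equal_ends_eq:
  assumes n: "n > 0"
  shows "equal_ends D n = diag_proj n ` {x \<in> carrier (PBorel D n). proj_quot n x = 1}"
proof (intro equalityI subsetI)
  fix X assume "X \<in> equal_ends D n"
  then obtain u where u: "\<forall>i<n. u i \<in> D" "u 0 = u (n - 1)" "X = diag_class D n u"
    by (auto simp: equal_ends_def)
  then show "X \<in> diag_proj n ` {x \<in> carrier (PBorel D n). proj_quot n x = 1}"
    using n by (intro image_eqI[of _ _ "proj_class D n (mat_diag n u)"])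
      (auto simp: diag_class_eq proj_quot_mat_diag mat_diag_Borel)
next
  fix X assume "X \<in> diag_proj n ` {x \<in> carrier (PBorel D n). proj_quot n x = 1}"
  then obtain A where A: "A \<in> carrier (Borel D n)" "corner_quot n A = 1" "X = diag_proj n (proj_class D n A)"
    using n by (auto simp: carrier_PBorel proj_quot_proj_class)
  have D0: "A $$ (n - 1, n - 1) \<in> D"
    using BorelD(3)[OF A(1)] n by auto
  have "A $$ (0, 0) = corner_quot n A * A $$ (n - 1, n - 1)"
    using D0 by (simp add: corner_quot_def mult.assoc)
  then have "A $$ (0, 0) = A $$ (n - 1, n - 1)"
    by (simp add: A(2))
  then show "X \<in> equal_ends D n"
    using A BorelD(3)[OF A(1)] by (auto simp: equal_ends_def diag_proj_proj_class intro!: exI[of _ "\<lambda>i. A $$ (i, i)"])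
qed

lemma equal_ends_normal:
  assumes "n > 0"
  shows "equal_ends D n \<lhd> PBorel_diag D n"
proof -
  interpret group_hom "PBorel D n" D_group "proj_quot n"
    using assms comm_group.axioms(2)[OF comm_group_D]
    by (simp add: group_hom_def group_hom_axioms_def group_PBorel proj_quot_hom)
  have "kernel (PBorel D n) D_group (proj_quot n) = {x \<in> carrier (PBorel D n). proj_quot n x = 1}"
    by (simp add: kernel_def unit_group_def)
  then show ?thesis
    unfolding equal_ends_eq[OF assms] using normal_kernel carrier_PBorel_diag[symmetric]
    by (intro normal_image_surj[OF _ group_PBorel_diag diag_proj_hom]) auto
qed

text \<open>Both subgroups that are factored out are killed by \<open>proj_quot\<close>: the
  unitriangular classes, and those with equal ends. The ratio therefore descends to the iterated
  quotient.\<close>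

lemma equal_ends_coset_imp:
  assumes n: "n > 0" and xy: "x \<in> carrier (PBorel D n)" "y \<in> carrier (PBorel D n)"
    and eq: "equal_ends D n #>\<^bsub>PBorel_diag D n\<^esub> diag_proj n x = equal_ends D n #>\<^bsub>PBorel_diag D n\<^esub> diag_proj n y"
  shows "proj_quot n x = proj_quot n y"
proof -
  interpret P: group "PBorel D n" by (rule group_PBorel)
  have "diag_proj n x \<in> carrier (PBorel_diag D n)" "diag_proj n y \<in> carrier (PBorel_diag D n)"
    using xy by (simp_all add: carrier_PBorel_diag)
  then obtain k where k: "k \<in> carrier (PBorel D n)" "proj_quot n k = 1"
    "diag_proj n x = diag_proj n k \<otimes>\<^bsub>PBorel_diag D n\<^esub> diag_proj n y"
    using normal.r_coset_eq_iff[OF equal_ends_normal[OF n]] eq by (auto simp: equal_ends_eq[OF n])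
  then have "diag_proj n x = diag_proj n (k \<otimes>\<^bsub>PBorel D n\<^esub> y)"
    using hom_mult[OF diag_proj_hom k(1) xy(2)] by simp
  then obtain u where u: "u \<in> proj_unitri D n" "x = u \<otimes>\<^bsub>PBorel D n\<^esub> (k \<otimes>\<^bsub>PBorel D n\<^esub> y)"
    using normal.r_coset_eq_iff[OF proj_unitri_normal xy(1) P.m_closed[OF k(1) xy(2)]] by (auto simp: diag_proj_def)
  then have "u \<in> carrier (PBorel D n)"
    using proj_unitri_subset by auto
  then show ?thesis
    using u k xy hom_mult[OF proj_quot_hom[OF n]] proj_quot_unitri[OF u(1) n] by (simp add: unit_group_def)
qed

section \<open>The affine group\<close>

lemma aff_mat_carrier [simp]: "aff_mat u r \<in> carrier_mat 2 2" "dim_row (aff_mat u r) = 2" "dim_col (aff_mat u r) = 2"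
  by (auto simp: aff_mat_def mat_of_rows_list_def)

lemma aff_mat_index [simp]:
  "aff_mat u r $$ (0, 0) = u" "aff_mat u r $$ (0, Suc 0) = r"
  "aff_mat u r $$ (Suc 0, 0) = 0" "aff_mat u r $$ (Suc 0, Suc 0) = 1"
  by (auto simp: aff_mat_def mat_of_rows_list_def)

lemma aff_mat_mult: "aff_mat u r * aff_mat v s = aff_mat (u * v) (u * s + r)"
  by (rule eq_matI) (auto simp: less_Suc_eq scalar_prod_def numeral_2_eq_2)

lemma aff_mat_one: "1\<^sub>m 2 = aff_mat 1 0"
  by (rule eq_matI) (auto simp: less_2_cases_iff)

lemma aff_mat_eq_iff: "aff_mat u r = aff_mat v s \<longleftrightarrow> u = v \<and> r = s"
  by (metis aff_mat_index(1,2))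

lemma Aff_simps [simp]:
  "A \<otimes>\<^bsub>Aff D\<^esub> B = A * B" "\<one>\<^bsub>Aff D\<^esub> = 1\<^sub>m 2"
  by (simp_all add: Aff_def GL_def units_of_def ring_mat_simps)

lemma carrier_Aff: "carrier (Aff D) = {aff_mat u r | u r. u \<in> D}"
  by (simp add: Aff_def)

lemma aff_mat_in_Aff [simp]: "u \<in> D \<Longrightarrow> aff_mat u r \<in> carrier (Aff D)"
  by (auto simp: carrier_Aff)

lemma group_Aff: "group (Aff D)"
proof (rule groupI)
  fix A assume "A \<in> carrier (Aff D)"
  then obtain u r where A: "u \<in> D" "A = aff_mat u r"
    by (auto simp: carrier_Aff)
  then have "aff_mat (uinv u) (- (uinv u * r)) \<otimes>\<^bsub>Aff D\<^esub> A = \<one>\<^bsub>Aff D\<^esub>"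
    by (simp add: aff_mat_mult aff_mat_one)
  then show "\<exists>B\<in>carrier (Aff D). B \<otimes>\<^bsub>Aff D\<^esub> A = \<one>\<^bsub>Aff D\<^esub>"
    using A(1) by (intro bexI[of _ "aff_mat (uinv u) (- (uinv u * r))"]) auto
qed (auto simp: carrier_Aff aff_mat_mult aff_mat_one aff_mat_eq_iff algebra_simps)

lemma Aff_subset_Borel: "carrier (Aff D) \<subseteq> carrier (Borel D 2)"
  by (auto simp: carrier_Aff carrier_Borel upper_triangular_def less_2_cases_iff)

lemma Aff_inclusion: "group_hom (Aff D) (Borel D 2) id"
  using Aff_subset_Borel
  by (auto simp: group_hom_def group_hom_axioms_def group_Aff group_Borel hom_def)

lemma unitri_2: "unitri 2 = range (aff_mat 1)"
proof (intro equalityI subsetI)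
  fix A :: "'b::idom mat" assume "A \<in> unitri 2"
  then have "A = aff_mat 1 (A $$ (0, 1))"
    by (intro eq_matI) (auto simp: unitri_def upper_triangular_def less_2_cases_iff)
  then show "A \<in> range (aff_mat 1)" by blast
qed (auto simp: unitri_def upper_triangular_def less_2_cases_iff)

definition aff_quot :: "'a mat \<Rightarrow> 'a" where
  "aff_quot A = A $$ (0, 0)"

lemma aff_quot_hom: "aff_quot \<in> hom (Aff D) D_group"
  by (intro homI) (auto simp: carrier_Aff aff_quot_def aff_mat_mult unit_group_def)

lemma unitri_2_normal: "unitri 2 \<lhd> Aff D"
proof -
  interpret group_hom "Aff D" D_group aff_quot
    using comm_group.axioms(2)[OF comm_group_D]
    by (simp add: group_hom_def group_hom_axioms_def group_Aff aff_quot_hom)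
  have "kernel (Aff D) D_group aff_quot = unitri 2"
    using D_one by (auto simp: kernel_def unitri_2 carrier_Aff aff_quot_def unit_group_def)
  then show ?thesis using normal_kernel by simp
qed

text \<open>Iterated commutators in \<open>Aff D\<close> agree with those in
  \<open>Borel D 2\<close>, where the matrix computations are available. No scalar has to be
  removed, since the lower diagonal entry is already 1.\<close>

lemma left_engel_Aff: "left_engel (Aff D) = unitri 2"
proof
  interpret inc: group_hom "Aff D" "Borel D 2" id by (rule Aff_inclusion)
  have engel_eq: "engel (Aff D) x g k = engel (Borel D 2) x g k"
    if "x \<in> carrier (Aff D)" "g \<in> carrier (Aff D)" for x g k
    using inc.hom_engel[OF that] by simp
  show "unitri 2 \<subseteq> left_engel (Aff D)"
  proof
    fix u :: "'a mat" assume u: "u \<in> unitri 2"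
    then have uA: "u \<in> carrier (Aff D)"
      using normal_imp_subgroup[OF unitri_2_normal] subgroup.subset by blast
    have "engel (Aff D) x u 2 = 1\<^sub>m 2" if x: "x \<in> carrier (Aff D)" for x
      using engel_eq[OF x uA] engel_unitri_eq_one[OF subsetD[OF Aff_subset_Borel x] u] by simp
    then show "u \<in> left_engel (Aff D)"
      using uA unfolding left_engel_def Aff_simps by blast
  qed
  show "left_engel (Aff D) \<subseteq> unitri 2"
  proof
    fix g assume g: "g \<in> left_engel (Aff D)"
    then have gA: "g \<in> carrier (Aff D)"
      by (simp add: left_engel_def)
    then obtain u r where ur: "u \<in> D" "g = aff_mat u r"
      by (auto simp: carrier_Aff)
    \<comment> \<open>The test matrix of \<open>engel_nontrivial\<close> for \<open>n = 2\<close>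
      and \<open>i = 0\<close> happens to lie in \<open>Aff D\<close>.\<close>
    have E: "addrow_mat 2 1 0 (Suc 0) = aff_mat 1 1"
      by (rule eq_matI) (auto simp: less_2_cases_iff)
    have "aff_mat 1 1 \<in> carrier (Aff D)"
      by simp
    then obtain k where "engel (Aff D) (aff_mat 1 1) g k = 1\<^sub>m 2"
      using g unfolding left_engel_def Aff_simps by blast
    then have "engel (Borel D 2) (aff_mat 1 1) g k $$ (0, Suc 0) = 0"
      using engel_eq[of "aff_mat 1 1" g k] gA by simp
    then have "u = 1"
      using engel_nontrivial[OF subsetD[OF Aff_subset_Borel gA], of 0 k] unfolding E ur(2) by auto
    then show "g \<in> unitri 2"
      using ur by (auto simp: unitri_2)
  qed
qed

lemma auto_image_unitri_2: "\<psi> \<in> auto (Aff D) \<Longrightarrow> \<psi> ` unitri 2 = unitri 2"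
  using auto_image_left_engel[OF group_Aff] by (simp add: left_engel_Aff)

definition aff_diag :: "'a \<Rightarrow> 'a mat set" where
  "aff_diag u = unitri 2 #>\<^bsub>Aff D\<^esub> aff_mat u 0"

lemma group_Aff_diag: "group (Aff_diag D)"
  unfolding Aff_diag_def by (rule normal.factorgroup_is_group[OF unitri_2_normal])

lemma aff_diag_coset:
  assumes "u \<in> D"
  shows "unitri 2 #>\<^bsub>Aff D\<^esub> aff_mat u r = aff_diag u"
proof -
  have "aff_mat u r = aff_mat 1 r * aff_mat u 0"
    by (simp add: aff_mat_mult)
  then show ?thesis
    unfolding aff_diag_def
      normal.r_coset_eq_iff[OF unitri_2_normal aff_mat_in_Aff[OF assms] aff_mat_in_Aff[OF assms]]
    by (auto simp: unitri_2)
qed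

lemma aff_diag_hom: "aff_diag \<in> hom D_group (Aff_diag D)"
proof -
  have "(\<lambda>u. aff_mat u 0) \<in> hom D_group (Aff D)"
    by (intro homI) (auto simp: aff_mat_mult unit_group_def)
  then show ?thesis
    using hom_compose[OF _ normal.r_coset_hom_Mod[OF unitri_2_normal]]
    by (auto simp: aff_diag_def[abs_def] Aff_diag_def comp_def)
qed

lemma carrier_Aff_diag: "carrier (Aff_diag D) = aff_diag ` D"
proof -
  have "carrier (Aff_diag D) = {unitri 2 #>\<^bsub>Aff D\<^esub> aff_mat u r | u r. u \<in> D}"
    by (auto simp: Aff_diag_def carrier_FactGroup carrier_Aff)
  then show ?thesis
    using aff_diag_coset by (auto simp: image_iff) metis+
qed

lemma comm_group_Aff_diag: "comm_group (Aff_diag D)"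
  using comm_group_surj[OF comm_group_D group_Aff_diag aff_diag_hom] by (simp add: carrier_Aff_diag)

abbreviation T_group :: "'a mat set set monoid" where
  "T_group \<equiv> torsion_free_part (Aff_diag D)"

definition aff_tf_class :: "'a \<Rightarrow> 'a mat set set" where
  "aff_tf_class u = torsion (Aff_diag D) #>\<^bsub>Aff_diag D\<^esub> aff_diag u"

lemma torsion_normal: "torsion (Aff_diag D) \<lhd> Aff_diag D"
  using comm_group.subgroup_imp_normal[OF comm_group_Aff_diag comm_group.subgroup_torsion[OF comm_group_Aff_diag]] .

lemma comm_group_T: "comm_group T_group"
  by (rule comm_group.torsion_free_part(1)[OF comm_group_Aff_diag])

lemma aff_tf_class_hom: "aff_tf_class \<in> hom D_group T_group"
  using hom_compose[OF aff_diag_hom normal.r_coset_hom_Mod[OF torsion_normal]]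
  by (simp add: aff_tf_class_def[abs_def] torsion_free_part_def comp_def)

lemma carrier_T: "carrier T_group = aff_tf_class ` D"
  by (auto simp: torsion_free_part_def carrier_FactGroup carrier_Aff_diag aff_tf_class_def)

lemma induced_map_Aff_auto: "\<psi> \<in> auto (Aff D) \<Longrightarrow> induced_map (Aff D) (unitri 2) \<psi> \<in> auto (Aff_diag D)"
  unfolding Aff_diag_def by (intro induced_map_auto unitri_2_normal auto_image_unitri_2)

lemma aff_tf_auto: "\<psi> \<in> auto (Aff D) \<Longrightarrow> aff_tf D \<psi> \<in> auto T_group"
  unfolding aff_tf_def torsion_free_part_def
  by (intro induced_map_auto torsion_normal auto_image_torsion group_Aff_diag induced_map_Aff_auto)

lemma reidemeister_number_Aff_ge:
  assumes \<psi>: "\<psi> \<in> auto (Aff D)"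
  shows "reidemeister_number T_group (aff_tf D \<psi>) \<le> reidemeister_number (Aff D) \<psi>"
proof -
  have "reidemeister_number T_group (aff_tf D \<psi>) \<le> reidemeister_number (Aff_diag D) (induced_map (Aff D) (unitri 2) \<psi>)"
    unfolding aff_tf_def torsion_free_part_def
    by (intro reidemeister_number_induced_map_le torsion_normal auto_image_torsion group_Aff_diag
        induced_map_Aff_auto \<psi>)
  also have "\<dots> \<le> reidemeister_number (Aff D) \<psi>"
    unfolding Aff_diag_def
    by (intro reidemeister_number_induced_map_le unitri_2_normal auto_image_unitri_2 \<psi>)
  finally show ?thesis .
qed

text \<open>The translation part \<open>r\<close> is absorbed by the coset of
  \<open>unitri 2\<close>, so only the diagonal entry of the image survives in the two
  quotients.\<close>

lemma aff_tf_class: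
  assumes \<psi>: "\<psi> \<in> auto (Aff D)" and u: "u \<in> D" and v: "v \<in> D" "\<psi> (aff_mat u 0) = aff_mat v r"
  shows "aff_tf D \<psi> (aff_tf_class u) = aff_tf_class v"
proof -
  have "induced_map (Aff D) (unitri 2) \<psi> (aff_diag u) = aff_diag v"
    using induced_map_coset[OF group_Aff _ auto_hom[OF \<psi>] auto_image_unitri_2[OF \<psi>] aff_mat_in_Aff[OF u]]
      normal_imp_subgroup[OF unitri_2_normal] subgroup.subset v aff_diag_coset[OF v(1)]
    by (metis aff_diag_def)
  moreover have "induced_map (Aff_diag D) (torsion (Aff_diag D)) f (torsion (Aff_diag D) #>\<^bsub>Aff_diag D\<^esub> aff_diag u) =
      torsion (Aff_diag D) #>\<^bsub>Aff_diag D\<^esub> f (aff_diag u)" if f: "f \<in> auto (Aff_diag D)" for f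
    using u by (intro induced_map_coset group_Aff_diag auto_hom[OF f] auto_image_torsion[OF group_Aff_diag f])
      (auto simp: torsion_def carrier_Aff_diag)
  ultimately show ?thesis
    using induced_map_Aff_auto[OF \<psi>] by (simp add: aff_tf_def aff_tf_class_def)
qed

text \<open>The rank bound passes from the unit group to the subgroup \<open>D\<close>, and from
  there along the surjection \<open>aff_tf_class\<close> onto \<open>T_group\<close>.\<close>

lemma reidemeister_number_aff_tf_infinite:
  assumes "finitely_generated (unit_group :: 'a monoid)" and \<psi>: "\<psi> \<in> auto (Aff D)"
    and "infinite (fixed_points T_group (aff_tf D \<psi>))"
  shows "reidemeister_number T_group (aff_tf D \<psi>) = \<infinity>"
proof -
  obtain r where "bounded_rank (unit_group :: 'a monoid) r"
    using comm_group.finitely_generated_imp_bounded_rank[OF comm_group_unit_group assms(1)] by blast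
  then have "bounded_rank D_group r"
    by (rule bounded_rank_subgroup[OF comm_group_unit_group subgroup_D])
  then have "bounded_rank T_group r"
    using bounded_rank_surj[OF comm_group_D comm_group_T aff_tf_class_hom] by (simp add: carrier_T)
  then show ?thesis
    using comm_group.torsion_free_part(2)[OF comm_group_Aff_diag] assms(3)
    by (intro comm_group.reidemeister_number_infinite[OF comm_group_T _ _ auto_hom[OF aff_tf_auto[OF \<psi>]]]) auto
qed

section \<open>Automorphisms of the projective group\<close>

lemma induced_diag_auto:
  assumes \<phi>: "\<phi> \<in> auto (PBorel D n)" and n: "n > 0"
  defines "\<phi>d \<equiv> induced_map (PBorel D n) (proj_unitri D n) \<phi>"
  shows "\<phi>d \<in> auto (PBorel_diag D n)"
    "\<And>x. x \<in> carrier (PBorel D n) \<Longrightarrow> \<phi>d (diag_proj n x) = diag_proj n (\<phi> x)"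
proof -
  have U: "\<phi> ` proj_unitri D n = proj_unitri D n"
    by (rule auto_image_proj_unitri[OF n \<phi>])
  show "\<phi>d \<in> auto (PBorel_diag D n)"
    unfolding \<phi>d_def PBorel_diag_def by (intro induced_map_auto proj_unitri_normal \<phi> U)
  show "\<phi>d (diag_proj n x) = diag_proj n (\<phi> x)" if "x \<in> carrier (PBorel D n)" for x
    unfolding \<phi>d_def diag_proj_def
    by (rule induced_map_coset[OF group_PBorel proj_unitri_subset auto_hom[OF \<phi>] U that])
qed

lemma induced_ends_coset:
  assumes \<phi>: "\<phi> \<in> auto (PBorel D n)" and n: "n > 0" and x: "x \<in> carrier (PBorel D n)"
  defines "\<phi>d \<equiv> induced_map (PBorel D n) (proj_unitri D n) \<phi>"
  assumes ends: "\<phi>d ` equal_ends D n = equal_ends D n"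
  shows "induced_map (PBorel_diag D n) (equal_ends D n) \<phi>d (equal_ends D n #>\<^bsub>PBorel_diag D n\<^esub> diag_proj n x) =
    equal_ends D n #>\<^bsub>PBorel_diag D n\<^esub> diag_proj n (\<phi> x)"
proof -
  have "equal_ends D n \<subseteq> carrier (PBorel_diag D n)"
    using normal_imp_subgroup[OF equal_ends_normal[OF n]] by (rule subgroup.subset)
  moreover have "diag_proj n x \<in> carrier (PBorel_diag D n)"
    using x by (simp add: carrier_PBorel_diag)
  ultimately show ?thesis
    using induced_map_coset[OF group_PBorel_diag _ auto_hom ends] induced_diag_auto[OF \<phi> n] x
    by (simp add: \<phi>d_def)
qed

lemma auto_induces_aff:
  assumes \<phi>: "\<phi> \<in> auto (PBorel D n)" and n: "n \<ge> 2"
  shows "\<exists>\<psi>\<in>auto (Aff D). induces_aff D n \<phi> \<psi>"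
proof -
  have n0: "n > 0" using n by simp
  obtain \<alpha> where \<alpha>: "bij \<alpha>" "\<And>r s. \<alpha> (r + s) = \<alpha> r + \<alpha> s"
    "\<And>r. \<phi> (proj_class D n (corner_mat n r)) = proj_class D n (corner_mat n (\<alpha> r))"
    using auto_corner[OF \<phi> n] by metis
  obtain \<beta> where \<beta>: "\<beta> \<in> auto D_group" "\<And>x. x \<in> carrier (PBorel D n) \<Longrightarrow> \<beta> (proj_quot n x) = proj_quot n (\<phi> x)"
    "\<And>u r. u \<in> D \<Longrightarrow> \<alpha> (u * r) = \<beta> u * \<alpha> r"
    using auto_proj_quot[OF \<phi> n \<alpha>(1,3)] by metis
  have \<beta>_closed: "\<beta> u \<in> D" if "u \<in> D" for u
    using auto_closed[OF \<beta>(1), of u] that by simp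
  have \<beta>_eq_iff: "\<beta> u = \<beta> v \<longleftrightarrow> u = v" if "u \<in> D" "v \<in> D" for u v
    using auto_eq_iff[OF \<beta>(1), of u v] that by simp
  have \<beta>_mult: "\<beta> (u * v) = \<beta> u * \<beta> v" if "u \<in> D" "v \<in> D" for u v
    using hom_mult[OF auto_hom[OF \<beta>(1)], of u v] that by (simp add: unit_group_def)
  have \<beta>_one: "\<beta> 1 = 1"
    using \<beta>_mult[of 1 1] D_nonzero[OF \<beta>_closed[OF D_one]] by simp
  define f where "f A = aff_mat (\<beta> (A $$ (0, 0))) (\<alpha> (A $$ (0, Suc 0)))" for A
  define \<psi> where "\<psi> = restrict f (carrier (Aff D))"
  \<comment> \<open>The upper right entry of a product is \<open>u * s + r\<close>; additivity of
    \<alpha> together with \<open>\<alpha> (u * s) = \<beta> u * \<alpha> s\<close> matches it with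
    that of the product of the images.\<close>
  have f_hom: "f \<in> hom (Aff D) (Aff D)"
    using \<beta>_closed
    by (intro homI) (auto simp: carrier_Aff f_def aff_mat_mult aff_mat_eq_iff \<beta>_mult \<beta>(3) \<alpha>(2))
  have "bij_betw f (carrier (Aff D)) (carrier (Aff D))"
  proof (rule bij_betw_imageI)
    show "inj_on f (carrier (Aff D))"
      using \<alpha>(1) \<beta>_eq_iff by (auto intro!: inj_onI simp: carrier_Aff f_def aff_mat_eq_iff bij_def inj_eq)
    show "f ` carrier (Aff D) = carrier (Aff D)"
    proof (intro equalityI subsetI)
      fix A assume "A \<in> carrier (Aff D)"
      then obtain u r where ur: "u \<in> D" "A = aff_mat u r" by (auto simp: carrier_Aff)
      obtain v where v: "v \<in> D" "u = \<beta> v"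
        using auto_bij[OF \<beta>(1)] ur(1) by (auto simp: bij_betw_def)
      obtain s where "r = \<alpha> s"
        using \<alpha>(1) by (metis bij_pointE)
      then have "A = f (aff_mat v s)"
        by (simp add: f_def ur(2) v(2))
      then show "A \<in> f ` carrier (Aff D)"
        using v(1) by auto
    qed (use f_hom in \<open>auto simp: hom_def\<close>)
  qed
  then have \<psi>: "\<psi> \<in> auto (Aff D)"
    unfolding \<psi>_def by (intro auto_restrictI f_hom group_Aff)
  define \<phi>d where "\<phi>d = induced_map (PBorel D n) (proj_unitri D n) \<phi>"
  define \<chi> where "\<chi> = induced_map (PBorel_diag D n) (equal_ends D n) \<phi>d"
  have \<phi>d: "\<phi>d \<in> auto (PBorel_diag D n)" "\<And>x. x \<in> carrier (PBorel D n) \<Longrightarrow> \<phi>d (diag_proj n x) = diag_proj n (\<phi> x)"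
    using induced_diag_auto[OF \<phi> n0] by (auto simp: \<phi>d_def)
  \<comment> \<open>As \<beta> is injective on \<open>D\<close> and fixes 1, the ratio of
    \<open>\<phi> x\<close> is 1 exactly when that of \<open>x\<close> is.\<close>
  have "\<phi> ` {x \<in> carrier (PBorel D n). proj_quot n x = 1} = {x \<in> carrier (PBorel D n). proj_quot n x = 1}"
    using \<beta>_eq_iff[OF proj_quot_closed[OF n0] D_one] \<beta>(2) \<beta>_one
    by (intro auto_image_Collect[OF \<phi>]) auto
  moreover have "\<phi>d ` equal_ends D n = diag_proj n ` \<phi> ` {x \<in> carrier (PBorel D n). proj_quot n x = 1}"
    unfolding equal_ends_eq[OF n0] image_image using \<phi>d(2) by (intro image_cong) auto
  ultimately have ends: "\<phi>d ` equal_ends D n = equal_ends D n"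
    by (simp add: equal_ends_eq[OF n0])
  have \<chi>: "\<chi> \<in> auto (PBorel_diag D n Mod equal_ends D n)"
    unfolding \<chi>_def by (intro induced_map_auto equal_ends_normal n0 \<phi>d(1) ends)
  have ratio: "corner_ratio D n \<chi> \<beta>"
    unfolding corner_ratio_def
  proof (intro allI impI, elim conjE)
    fix u v assume u: "\<forall>i<n. u i \<in> D" and v: "\<forall>i<n. v i \<in> D"
      and eq: "\<chi> (equal_ends D n #>\<^bsub>PBorel_diag D n\<^esub> diag_class D n u) =
        equal_ends D n #>\<^bsub>PBorel_diag D n\<^esub> diag_class D n v"
    define x y where "x = proj_class D n (mat_diag n u)" and "y = proj_class D n (mat_diag n v)"
    have xy: "x \<in> carrier (PBorel D n)" "y \<in> carrier (PBorel D n)"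
      using u v by (auto simp: x_def y_def mat_diag_Borel)
    have "\<chi> (equal_ends D n #>\<^bsub>PBorel_diag D n\<^esub> diag_proj n x) =
        equal_ends D n #>\<^bsub>PBorel_diag D n\<^esub> diag_proj n (\<phi> x)"
      unfolding \<chi>_def \<phi>d_def using ends by (intro induced_ends_coset[OF \<phi> n0 xy(1)]) (simp add: \<phi>d_def)
    then have "proj_quot n (\<phi> x) = proj_quot n y"
      using eq u v xy auto_closed[OF \<phi>] by (intro equal_ends_coset_imp[OF n0]) (auto simp: diag_class_eq x_def y_def)
    then have "\<beta> (proj_quot n x) = proj_quot n y"
      using \<beta>(2)[OF xy(1)] by simp
    then show "\<beta> (u 0 * uinv (u (n - 1))) = v 0 * uinv (v (n - 1))"
      using u v n0 by (simp add: x_def y_def proj_quot_mat_diag)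
  qed
  have "induces_aff D n \<phi> \<psi>"
    unfolding induces_aff_def Let_def \<phi>d_def[symmetric] \<chi>_def[symmetric]
    using \<phi> \<psi> \<phi>d(1) ends \<chi> \<alpha> \<beta>(1) ratio
    by (intro conjI exI[of _ \<alpha>] exI[of _ \<beta>]) (auto simp: \<psi>_def f_def)
  then show ?thesis using \<psi> by blast
qed

text \<open>The equivariant surjection is the ratio followed by the class in \<open>T_group\<close>.
  Its equivariance is extracted from \<open>induces_aff\<close>, so the bound holds for every
  related \<psi>.\<close>

lemma reidemeister_number_PBorel_ge:
  assumes ind: "induces_aff D n \<phi> \<psi>" and n: "n \<ge> 2"
  shows "reidemeister_number T_group (aff_tf D \<psi>) \<le> reidemeister_number (PBorel D n) \<phi>"
proof -
  have n0: "n > 0" using n by simp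
  define \<phi>d where "\<phi>d = induced_map (PBorel D n) (proj_unitri D n) \<phi>"
  define \<chi> where "\<chi> = induced_map (PBorel_diag D n) (equal_ends D n) \<phi>d"
  obtain \<alpha> \<beta> where \<phi>: "\<phi> \<in> auto (PBorel D n)" and \<psi>: "\<psi> \<in> auto (Aff D)"
    and ends: "\<phi>d ` equal_ends D n = equal_ends D n"
    and ratio: "corner_ratio D n \<chi> \<beta>"
    and \<psi>_eq: "\<And>u r. u \<in> D \<Longrightarrow> \<psi> (aff_mat u r) = aff_mat (\<beta> u) (\<alpha> r)"
    using ind unfolding induces_aff_def Let_def \<phi>d_def[symmetric] \<chi>_def[symmetric] by metis
  have \<beta>: "\<beta> (proj_quot n x) = proj_quot n (\<phi> x)" if x: "x \<in> carrier (PBorel D n)" for x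
  proof -
    obtain A where A: "A \<in> carrier (Borel D n)" "x = proj_class D n A"
      using x by (auto simp: carrier_PBorel)
    obtain B where B: "B \<in> carrier (Borel D n)" "\<phi> x = proj_class D n B"
      using auto_closed[OF \<phi> x] by (auto simp: carrier_PBorel)
    have "\<chi> (equal_ends D n #>\<^bsub>PBorel_diag D n\<^esub> diag_proj n x) =
        equal_ends D n #>\<^bsub>PBorel_diag D n\<^esub> diag_proj n (\<phi> x)"
      unfolding \<chi>_def \<phi>d_def using ends by (intro induced_ends_coset[OF \<phi> n0 x]) (simp add: \<phi>d_def)
    then have "\<chi> (equal_ends D n #>\<^bsub>PBorel_diag D n\<^esub> diag_class D n (\<lambda>i. A $$ (i, i))) =
        equal_ends D n #>\<^bsub>PBorel_diag D n\<^esub> diag_class D n (\<lambda>i. B $$ (i, i))"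
      using A B diag_proj_proj_class by simp
    then have "\<beta> (corner_quot n A) = corner_quot n B"
      \<comment> \<open>The diagonals of representatives of \<open>x\<close> and
        \<open>\<phi> x\<close> serve as the two diagonal matrices in
        \<open>corner_ratio\<close>.\<close>
      using ratio[unfolded corner_ratio_def, rule_format, of "\<lambda>i. A $$ (i, i)" "\<lambda>i. B $$ (i, i)"]
        BorelD(3)[OF A(1)] BorelD(3)[OF B(1)] by (simp add: corner_quot_def)
    then show ?thesis
      using A B n0 by (simp add: proj_quot_proj_class)
  qed
  show ?thesis
  proof (rule reidemeister_number_mono[OF group_PBorel comm_group.axioms(2)[OF comm_group_T]])
    show "(\<lambda>x. aff_tf_class (proj_quot n x)) \<in> hom (PBorel D n) T_group"
      using hom_compose[OF proj_quot_hom[OF n0] aff_tf_class_hom] by (simp add: comp_def)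
    show "(\<lambda>x. aff_tf_class (proj_quot n x)) ` carrier (PBorel D n) = carrier T_group"
      using image_image[of aff_tf_class "proj_quot n" "carrier (PBorel D n)"]
      by (simp add: carrier_T proj_quot_surj[OF n])
    show "\<phi> \<in> carrier (PBorel D n) \<rightarrow> carrier (PBorel D n)"
      using auto_closed[OF \<phi>] by auto
    fix x assume x: "x \<in> carrier (PBorel D n)"
    then show "aff_tf_class (proj_quot n (\<phi> x)) = aff_tf D \<psi> (aff_tf_class (proj_quot n x))"
      using aff_tf_class[OF \<psi> proj_quot_closed[OF n0 x] proj_quot_closed[OF n0 auto_closed[OF \<phi> x]]]
        \<psi>_eq[OF proj_quot_closed[OF n0 x]] \<beta>[OF x] by auto
  qed
qed

section \<open>Automorphisms of the Borel group\<close>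

text \<open>Commuting with transvections leaves a scalar plus a corner entry. A diagonal matrix with
  distinct first and last entries then removes the corner.\<close>

lemma centralizer_Borel:
  assumes n: "n \<ge> 2" and u: "u \<in> D" "u \<noteq> 1"
  shows "centralizer (Borel D n) (carrier (Borel D n)) = scalars D n"
proof (intro equalityI subsetI)
  fix A assume "A \<in> centralizer (Borel D n) (carrier (Borel D n))"
  then have A: "A \<in> carrier (Borel D n)" and comm: "\<And>B. B \<in> carrier (Borel D n) \<Longrightarrow> A * B = B * A"
    by (auto simp: centralizer_def)
  have E: "A * addrow_mat n 1 i j = addrow_mat n 1 i j * A" if "i < j" "j < n" for i j
    by (intro comm unitriD(4) addrow_mat_unitri that(1))
  define T where "T = mat_diag n (\<lambda>i. if i = 0 then u else 1)"
  have "T \<in> carrier (Borel D n)"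
    unfolding T_def using u by (intro mat_diag_Borel) auto
  from comm[OF this] have "(A * T) $$ (0, n - 1) = (T * A) $$ (0, n - 1)"
    by simp
  \<comment> \<open>As \<open>n \<ge> 2\<close>, the last diagonal entry of \<open>T\<close> is 1,
    while the first is \<open>u\<close>.\<close>
  then have "A $$ (0, n - 1) = u * A $$ (0, n - 1)"
    using n BorelD(1)[OF A] mat_diag_mult_right[of A n n "\<lambda>i. if i = 0 then u else 1"]
      mat_diag_mult_left[of A n n "\<lambda>i. if i = 0 then u else 1"] by (simp add: T_def)
  then have 0: "A $$ (0, n - 1) = 0"
    using u(2) by simp
  define a where "a = A $$ (0, 0)"
  have "A $$ (i, j) = (if i = j then a else 0)" if "i < n" "j < n" for i j
    using commute_transvections_entries[OF A E that] 0 by (simp add: a_def)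
  then have "A = a \<cdot>\<^sub>m 1\<^sub>m n"
    using BorelD(1)[OF A] by (intro eq_matI) auto
  moreover have "a \<in> D"
    using BorelD(3)[OF A, of 0] n by (simp add: a_def)
  ultimately show "A \<in> scalars D n"
    by (auto simp: scalars_def)
next
  fix A assume A: "A \<in> scalars D n"
  then have "A \<in> carrier (Borel D n)"
    using subgroup.subset[OF normal_imp_subgroup[OF scalars_normal]] by blast
  then show "A \<in> centralizer (Borel D n) (carrier (Borel D n))"
    using A scalars_commute by (auto simp: centralizer_def scalars_def)
qed

text \<open>For \<open>D = {1}\<close> the center contains all corner matrices, so the description
  of the scalars as the center fails; they are then trivial. In the other case they are the
  center.\<close>

lemma auto_image_scalars:
  assumes \<phi>: "\<phi> \<in> auto (Borel D n)" and n: "n \<ge> 2"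
  shows "\<phi> ` scalars D n = scalars D n"
proof (cases "D = {1}")
  case True
  then have "scalars D n = {1\<^sub>m n}"
    by (auto simp: scalars_def intro!: eq_matI)
  then show ?thesis
    using group_hom.hom_one[OF auto_group_hom[OF group_Borel \<phi>]] by simp
next
  case False
  then obtain u where "u \<in> D" "u \<noteq> 1"
    using D_one by blast
  then show ?thesis
    using auto_image_centralizer[OF group_Borel \<phi> order_refl] auto_bij[OF \<phi>] centralizer_Borel[OF n]
    by (simp add: bij_betw_def)
qed

lemma Borel_induced_auto:
  assumes "\<phi> \<in> auto (Borel D n)" "n \<ge> 2"
  shows "induced_map (Borel D n) (scalars D n) \<phi> \<in> auto (PBorel D n)"
    "reidemeister_number (PBorel D n) (induced_map (Borel D n) (scalars D n) \<phi>) \<le> reidemeister_number (Borel D n) \<phi>"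
  unfolding PBorel_def
  by (intro induced_map_auto reidemeister_number_induced_map_le scalars_normal auto_image_scalars assms)+

end

theorem theorem1p2:
  fixes D :: "'a::idom set"
  assumes D: "D = carrier unit_group \<or> torsion_complement D"
  shows
    \<comment> \<open>(0)\<close>
    "(\<forall>\<psi>\<in>auto (Aff D).
        induced_map (Aff D) (unitri 2) \<psi> \<in> auto (Aff_diag D) \<and>
        aff_tf D \<psi> \<in> auto (torsion_free_part (Aff_diag D)) \<and>
        reidemeister_number (Aff D) \<psi>
          \<ge> reidemeister_number (torsion_free_part (Aff_diag D)) (aff_tf D \<psi>))
     \<and>
     \<comment> \<open>(i)\<close>
     (\<forall>n\<ge>2.
        (\<forall>\<phi>\<in>auto (Borel D n). \<exists>\<psi>\<in>auto (Aff D). Borel_induces_aff D n \<phi> \<psi> \<and>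
           reidemeister_number (Borel D n) \<phi>
             \<ge> reidemeister_number (torsion_free_part (Aff_diag D)) (aff_tf D \<psi>)) \<and>
        (\<forall>\<phi>\<in>auto (PBorel D n). \<exists>\<psi>\<in>auto (Aff D). induces_aff D n \<phi> \<psi> \<and>
           reidemeister_number (PBorel D n) \<phi>
             \<ge> reidemeister_number (torsion_free_part (Aff_diag D)) (aff_tf D \<psi>)))
     \<and>
     \<comment> \<open>(ii)\<close>
     (finitely_generated (unit_group :: 'a monoid) \<longrightarrow>
        (\<forall>n\<ge>2. \<forall>\<psi>\<in>auto (Aff D).
           infinite (fixed_points (torsion_free_part (Aff_diag D)) (aff_tf D \<psi>)) \<longrightarrow>
           (\<forall>\<phi>\<in>auto (Borel D n). Borel_induces_aff D n \<phi> \<psi> \<longrightarrow>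
              reidemeister_number (Borel D n) \<phi> = \<infinity>) \<and>
           (\<forall>\<phi>\<in>auto (PBorel D n). induces_aff D n \<phi> \<psi> \<longrightarrow>
              reidemeister_number (PBorel D n) \<phi> = \<infinity>)) \<and>
        ((\<forall>\<psi>\<in>auto (Aff D).
            infinite (fixed_points (torsion_free_part (Aff_diag D)) (aff_tf D \<psi>))) \<longrightarrow>
         (\<forall>n\<ge>2. property_R_infinity (Borel D n) \<and> property_R_infinity (PBorel D n)) \<and>
         property_R_infinity (Aff D)))"
proof -
  have "subgroup D unit_group"
    using D group.subgroup_self[OF comm_group.axioms(2)[OF comm_group_unit_group]]
    by (auto simp: torsion_complement_def)
  then interpret unit_subgroup D by (rule unit_subgroup.intro)
  have ex_PBorel: "\<exists>\<psi>\<in>auto (Aff D). induces_aff D n \<phi> \<psi> \<and>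
      reidemeister_number T_group (aff_tf D \<psi>) \<le> reidemeister_number (PBorel D n) \<phi>"
    if "n \<ge> 2" "\<phi> \<in> auto (PBorel D n)" for n \<phi>
    using auto_induces_aff[OF that(2,1)] reidemeister_number_PBorel_ge[OF _ that(1)] by blast
  have ge_Borel: "reidemeister_number T_group (aff_tf D \<psi>) \<le> reidemeister_number (Borel D n) \<phi>"
    if "n \<ge> 2" "\<phi> \<in> auto (Borel D n)" "Borel_induces_aff D n \<phi> \<psi>" for n \<phi> \<psi>
    using reidemeister_number_PBorel_ge[OF that(3)[unfolded Borel_induces_aff_def] that(1)]
      Borel_induced_auto(2)[OF that(2,1)] by (rule order_trans)
  have ex_Borel: "\<exists>\<psi>\<in>auto (Aff D). Borel_induces_aff D n \<phi> \<psi> \<and>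
      reidemeister_number T_group (aff_tf D \<psi>) \<le> reidemeister_number (Borel D n) \<phi>"
    if "n \<ge> 2" "\<phi> \<in> auto (Borel D n)" for n \<phi>
    using auto_induces_aff[OF Borel_induced_auto(1)[OF that(2,1)] that(1)] ge_Borel[OF that]
    by (auto simp: Borel_induces_aff_def)
  note infinite = reidemeister_number_aff_tf_infinite
  have top: "x = \<infinity>" if "y \<le> x" "y = \<infinity>" for x y :: enat
    using that by simp
  show ?thesis
  proof (intro conjI impI ballI allI)
    fix n :: nat and \<psi>
    assume "finitely_generated (unit_group :: 'a monoid)" "n \<ge> 2" "\<psi> \<in> auto (Aff D)"
      "infinite (fixed_points T_group (aff_tf D \<psi>))"
    note inf = infinite[OF this(1,3,4)] and n = this(2)
    show "reidemeister_number (Borel D n) \<phi> = \<infinity>" if "\<phi> \<in> auto (Borel D n)" "Borel_induces_aff D n \<phi> \<psi>"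
      for \<phi> using top[OF ge_Borel[OF n that] inf] .
    show "reidemeister_number (PBorel D n) \<phi> = \<infinity>" if "\<phi> \<in> auto (PBorel D n)" "induces_aff D n \<phi> \<psi>"
      for \<phi> using top[OF reidemeister_number_PBorel_ge[OF that(2) n] inf] .
  next
    assume fg: "finitely_generated (unit_group :: 'a monoid)"
      and all: "\<forall>\<psi>\<in>auto (Aff D). infinite (fixed_points T_group (aff_tf D \<psi>))"
    note inf = infinite[OF fg _ bspec[OF all]]
    show "property_R_infinity (Aff D)"
      unfolding property_R_infinity_def using top[OF reidemeister_number_Aff_ge inf] by blast
    fix n :: nat assume n: "n \<ge> 2"
    show "property_R_infinity (Borel D n)"
      unfolding property_R_infinity_def using ex_Borel[OF n] top[OF _ inf] by blast
    show "property_R_infinity (PBorel D n)"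
      unfolding property_R_infinity_def using ex_PBorel[OF n] top[OF _ inf] by blast
  qed (use induced_map_Aff_auto aff_tf_auto reidemeister_number_Aff_ge ex_Borel ex_PBorel in auto)
qed

end
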